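(* Let $F(w,x)$, $w\in\mathbb{R}^n$, $x\in\mathcal{X}$, be a (possibly nonconvex) function and $f(w)=\mathbb{E}_x[F(w,x)]$. Assume that each $F(\cdot,x)$ is Lipschitz continuous with constant $L_0(F(\cdot,x))\le L_0$, that $f$ is Lipschitz continuous, and that $f(w)\ge f^\ast$ for all $w\in\mathbb{R}^n$. Let the sequence $\{w_k\}_{k\ge0}$ be generated by Algorithm SZO-SP (described in the context), and let $\bar n\ge\mathbb{E}_{x_k}[\bar n(x_k)]$ for all $k\ge0$. Then, for an appropriate choice of the learning rates $h_k$ and the smoothing parameter $\mu$, $$\mathbb{E}_{\bar{\mathcal{U}}_N,\mathcal{X}_N}\big[\|\nabla f_\mu(w_N)\|^2\big]\le\epsilon\quad\text{if}\quad N\ge\mathcal{O}\Big(\frac{\bar n^3}{\epsilon^2}\Big),$$ where $\bar{\mathcal{U}}_N=(\bar u_0,\ldots,\bar u_N)$ and $\mathcal{X}_N=(x_0,\ldots,x_N)$.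
   Context: Norms $\|\cdot\|$ are Euclidean. $x$ is a random input in $\mathcal{X}$ and $\mathbb{E}_x$ is the expectation over inputs. The problem is $\min_w f(w)$ with $f(w)=\mathbb{E}_x[F(w,x)]$. In the setting considered (linear stochastic structured prediction), $F(w,x)$ is defined with respect to a linear model $w^\top\phi(x,y)$, where $\phi(x,y)\in\mathbb{R}^n$ is a joint, possibly sparse, feature vector of the input $x$ and an output $y$ in the set $\mathcal{Y}(x)$ of outputs for $x$. Lipschitz continuity of $F(\cdot,x)$ means $|F(w,x)-F(w',x)|\le L_0(F(\cdot,x))\,\|w-w'\|$ for all $w,w'$. Sparse perturbation: for an input $x$, the random vector $\bar u\in\mathbb{R}^n$ is a zero-mean Gaussian vector with unit covariance restricted to the active coordinates, i.e. those $i$ for which there exists $y\in\mathcal{Y}(x)$ with $\phi_i(x,y)\ne0$; the other coordinates are not perturbed ($\bar u_i=0$). The effective number of perturbed parameters for $x$ is $\bar n(x):=\|\bar u\|_0$, the number of nonzero coordinates of $\bar u$. Sparse Gaussian approximation: $f_\mu(w)=\mathbb{E}_{\bar u}[f(w+\mu\bar u)]$ with smoothing parameter $\mu>0$; since the distribution of $\bar u$ depends on $x$, the expectation is taken over $x$ and $\bar u$, i.e. of $F(w+\mu\bar u,x)$. Algorithm SZO-SP: input a sequence of learning rates $h_k$ and a smoothing parameter $\mu>0$; initialize $w_0=0$; for each $k\ge0$, sample an input $x_k$ and a sparse perturbation $\bar u_k$ (for $x_k$), compute $s_\mu(w_k):=\frac{F(w_k+\mu\bar u_k,x_k)-F(w_k,x_k)}{\mu}\,\bar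 u_k$, and update $w_{k+1}=w_k-h_k\,s_\mu(w_k)$. The condition on $N$ expresses iteration complexity: the number of iterations necessary to guarantee accuracy $\epsilon$ for the expected squared norm of the gradient of $f_\mu$ is of order $\bar n^3/\epsilon^2$. *)

theory Defs
  imports "HOL-Probability.Probability"
begin

text \<open>
  The constant hidden in the complexity bound must not depend on the dimension \<open>n\<close>, so \<open>n\<close> is
  quantified inside the statement and cannot be a type. Vectors of \<open>n\<close>-dimensional Euclidean
  space are functions \<open>nat \<Rightarrow> real\<close> that vanish from index \<open>n\<close> on (the carrier of
  \<^term>\<open>Euclidean_space n\<close>).
\<close>

type_synonym vec = "nat \<Rightarrow> real"

definition Rn :: "nat \<Rightarrow> vec set" where
  "Rn n = {w. \<forall>i\<ge>n. w i = 0}"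

lemma Rn_eq_topspace: "Rn n = topspace (Euclidean_space n)"
  by (auto simp: Rn_def topspace_Euclidean_space)

definition vnorm :: "nat \<Rightarrow> vec \<Rightarrow> real" where
  "vnorm n w = L2_set w {..<n}"

definition vinner :: "nat \<Rightarrow> vec \<Rightarrow> vec \<Rightarrow> real" where
  "vinner n v w = (\<Sum>i<n. v i * w i)"

definition l0norm :: "nat \<Rightarrow> vec \<Rightarrow> nat" where
  "l0norm n w = card {i. i < n \<and> w i \<noteq> 0}"

definition lipschitz_Rn :: "nat \<Rightarrow> real \<Rightarrow> (vec \<Rightarrow> real) \<Rightarrow> bool" where
  "lipschitz_Rn n L g \<longleftrightarrow>
     (\<forall>w\<in>Rn n. \<forall>w'\<in>Rn n. \<bar>g w - g w'\<bar> \<le> L * vnorm n (\<lambda>i. w i - w' i))"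

definition has_gradient :: "nat \<Rightarrow> (vec \<Rightarrow> real) \<Rightarrow> vec \<Rightarrow> vec \<Rightarrow> bool" where
  "has_gradient n g D w \<longleftrightarrow> D \<in> Rn n \<and>
     (\<forall>e>0. \<exists>d>0. \<forall>v\<in>Rn n. vnorm n (\<lambda>i. v i - w i) < d \<longrightarrow>
        \<bar>g v - g w - vinner n D (\<lambda>i. v i - w i)\<bar> \<le> e * vnorm n (\<lambda>i. v i - w i))"

definition gradient :: "nat \<Rightarrow> (vec \<Rightarrow> real) \<Rightarrow> vec \<Rightarrow> vec" where
  "gradient n g w = (THE D. has_gradient n g D w)"

definition active :: "nat \<Rightarrow> ('x \<Rightarrow> 'y set) \<Rightarrow> ('x \<Rightarrow> 'y \<Rightarrow> vec) \<Rightarrow> 'x \<Rightarrow> nat set" where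
  "active n Y \<phi> x = {i. i < n \<and> (\<exists>y\<in>Y x. \<phi> x y i \<noteq> 0)}"

text \<open>
  One draw of the algorithm is a pair \<open>(x, z)\<close> of an input and an independent standard Gaussian
  vector \<open>z\<close> (extensional on \<open>{..<n}\<close>). Given \<open>x\<close>, the vector \<open>sparse_pert n Y \<phi> (x, z)\<close> has
  independent standard normal entries at the active coordinates of \<open>x\<close> and zeros elsewhere,
  which is the law of the sparse perturbation for \<open>x\<close>.
\<close>

definition draw :: "nat \<Rightarrow> 'x measure \<Rightarrow> ('x \<times> vec) measure" where
  "draw n M = M \<Otimes>\<^sub>M (\<Pi>\<^sub>M i\<in>{..<n}. density lborel std_normal_density)"

definition sparse_pert ::
    "nat \<Rightarrow> ('x \<Rightarrow> 'y set) \<Rightarrow> ('x \<Rightarrow> 'y \<Rightarrow> vec) \<Rightarrow> 'x \<times> vec \<Rightarrow> vec" where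
  "sparse_pert n Y \<phi> p = (\<lambda>i. if i \<in> active n Y \<phi> (fst p) then snd p i else 0)"

definition objective :: "'x measure \<Rightarrow> (vec \<Rightarrow> 'x \<Rightarrow> real) \<Rightarrow> vec \<Rightarrow> real" where
  "objective M F w = (\<integral>x. F w x \<partial>M)"

definition smoothed ::
    "nat \<Rightarrow> 'x measure \<Rightarrow> ('x \<Rightarrow> 'y set) \<Rightarrow> ('x \<Rightarrow> 'y \<Rightarrow> vec) \<Rightarrow>
     (vec \<Rightarrow> 'x \<Rightarrow> real) \<Rightarrow> real \<Rightarrow> vec \<Rightarrow> real" where
  "smoothed n M Y \<phi> F \<mu> w =
     (\<integral>p. F (\<lambda>i. w i + \<mu> * sparse_pert n Y \<phi> p i) (fst p) \<partial>draw n M)"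

definition grad_est :: "(vec \<Rightarrow> 'x \<Rightarrow> real) \<Rightarrow> real \<Rightarrow> vec \<Rightarrow> 'x \<Rightarrow> vec \<Rightarrow> vec" where
  "grad_est F \<mu> w x u = (\<lambda>i. (F (\<lambda>j. w j + \<mu> * u j) x - F w x) / \<mu> * u i)"

primrec szo_sp ::
    "(vec \<Rightarrow> 'x \<Rightarrow> real) \<Rightarrow> real \<Rightarrow> (nat \<Rightarrow> real) \<Rightarrow> (nat \<Rightarrow> 'x) \<Rightarrow> (nat \<Rightarrow> vec) \<Rightarrow> nat \<Rightarrow> vec" where
  "szo_sp F \<mu> h xs us 0 = (\<lambda>i. 0)"
| "szo_sp F \<mu> h xs us (Suc k) =
     (\<lambda>i. szo_sp F \<mu> h xs us k i
            - h k * grad_est F \<mu> (szo_sp F \<mu> h xs us k) (xs k) (us k) i)"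

text \<open>
  The iterate as a random variable on the space of draws, where \<open>\<omega> k\<close> is the draw of
  iteration \<open>k\<close>.
\<close>

definition iterate ::
    "nat \<Rightarrow> ('x \<Rightarrow> 'y set) \<Rightarrow> ('x \<Rightarrow> 'y \<Rightarrow> vec) \<Rightarrow> (vec \<Rightarrow> 'x \<Rightarrow> real) \<Rightarrow> real \<Rightarrow>
     (nat \<Rightarrow> real) \<Rightarrow> nat \<Rightarrow> (nat \<Rightarrow> 'x \<times> vec) \<Rightarrow> vec" where
  "iterate n Y \<phi> F \<mu> h k \<omega> =
     szo_sp F \<mu> h (\<lambda>j. fst (\<omega> j)) (\<lambda>j. sparse_pert n Y \<phi> (\<omega> j)) k"

end

theory Submission
  imports Defs
begin

text \<open>
  Since \<open>F\<close> depends on \<open>w\<close> only through the linear scores, \<open>F(\<cdot>, x)\<close> is Lipschitz in the seminorm of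
  the coordinates active for \<open>x\<close>. Let \<open>\<pi>\<^sub>i\<close> be the probability that coordinate \<open>i\<close> is active, so
  that \<open>m = \<Sum>\<^sub>i \<pi>\<^sub>i\<close> is the expected number of perturbed coordinates. The curvature of \<open>f\<^sub>\<mu>\<close> along
  \<open>v\<close> is at most a multiple of \<open>q(v) K / \<mu>\<close> with \<open>q(v) = \<Sum>\<^sub>i \<pi>\<^sub>i v\<^sub>i\<^sup>2\<close>, and the gradient estimator \<open>s\<close>
  satisfies \<open>E q(s) \<le> 3 K\<^sup>2 m\<^sup>2\<close>; measuring both in \<open>q\<close> is what avoids second moments of the number of
  active coordinates. The descent inequality therefore bounds the average over \<open>k < N\<close> of
  \<open>E \<parallel>\<nabla>f\<^sub>\<mu>(w\<^sub>k)\<parallel>\<^sup>2\<close> by \<open>\<Delta>\<^sub>\<mu> / (h N) + h B\<close> with \<open>B = 6 K\<^sup>3 m\<^sup>2 / \<mu>\<close>. For \<open>\<mu>\<close> large the initial gap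
  \<open>\<Delta>\<^sub>\<mu>\<close> is at most \<open>2 K \<mu> m\<close>, so \<open>\<Delta>\<^sub>\<mu> B\<close> is of order \<open>K\<^sup>4 m\<^sup>3\<close>, whatever \<open>f(0) - f\<^sup>*\<close> is.

  The bound concerns the last iterate and all large \<open>N\<close>: once some \<open>w\<^sub>k\<close> is good, the remaining
  learning rates are chosen so small that the iterates stay good.
\<close>

section \<open>Gaussian shifts\<close>

abbreviation stdn :: "real measure" where
  "stdn \<equiv> density lborel (\<lambda>x. ennreal (std_normal_density x))"

abbreviation gauss :: "'i set \<Rightarrow> ('i \<Rightarrow> real) measure" where
  "gauss I \<equiv> \<Pi>\<^sub>M i\<in>I. stdn"

interpretation stdn: prob_space stdn
  by (rule prob_space_normal_density) simp

interpretation gauss: product_prob_space "\<lambda>_ :: 'i. stdn" for I :: "'i set"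
  by unfold_locales

lemma stdn_moments:
  shows integrable_stdn_power: "integrable stdn (\<lambda>t. t ^ k)"
    and integral_stdn_1: "(\<integral>t. t \<partial>stdn) = 0"
    and integral_stdn_2: "(\<integral>t. t\<^sup>2 \<partial>stdn) = 1"
    and integral_stdn_4: "(\<integral>t. t ^ 4 \<partial>stdn) = 3"
proof -
  show "integrable stdn (\<lambda>t. t ^ k)"
    using integrable_std_normal_moment[of k] by (subst integrable_real_density) auto
  show "(\<integral>t. t \<partial>stdn) = 0"
    using integral_std_normal_moment_odd[of 0] by (subst integral_real_density) auto
  show "(\<integral>t. t\<^sup>2 \<partial>stdn) = 1"
    using integral_std_normal_moment_even[of 1] by (subst integral_real_density) auto
  have "fact 4 = (24 :: real)" by (simp add: fact_numeral)
  then show "(\<integral>t. t ^ 4 \<partial>stdn) = 3"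
    using integral_std_normal_moment_even[of 2] by (subst integral_real_density) auto
qed

text \<open>The one-dimensional Cameron-Martin formula. A translation turns the Lebesgue density at
  \<open>t\<close> into \<open>std_normal_density (t - c)\<close>, and completing the square in the
  exponent identifies the ratio to \<open>std_normal_density t\<close> with the exponential
  weight.\<close>

lemma stdn_shift:
  "distr stdn stdn (\<lambda>t. t + c) = density stdn (\<lambda>t. ennreal (exp (c * t - c\<^sup>2 / 2)))"
proof (rule measure_eqI)
  fix A assume "A \<in> sets (distr stdn stdn (\<lambda>t. t + c))"
  then have A [measurable]: "A \<in> sets borel" by simp
  have "emeasure (distr stdn stdn (\<lambda>t. t + c)) A = (\<integral>\<^sup>+t. indicator A t \<partial>distr stdn stdn (\<lambda>t. t + c))"
    by simp
  also have "\<dots> = (\<integral>\<^sup>+t. ennreal (std_normal_density t) * indicator A (t + c) \<partial>lborel)"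
    by (subst nn_integral_distr) (simp_all add: nn_integral_density)
  also have "\<dots> = (\<integral>\<^sup>+t. ennreal (std_normal_density (t - c)) * indicator A t \<partial>lborel)"
    by (subst nn_integral_real_affine[of _ 1 "- c"]) auto
  also have "\<dots> = (\<integral>\<^sup>+t. ennreal (std_normal_density t) * (ennreal (exp (c * t - c\<^sup>2 / 2)) * indicator A t) \<partial>lborel)"
  proof (intro nn_integral_cong)
    fix t :: real
    have "- (t - c)\<^sup>2 / 2 = - t\<^sup>2 / 2 + (c * t - c\<^sup>2 / 2)"
      by (simp add: power2_eq_square field_simps)
    then have "std_normal_density (t - c) = std_normal_density t * exp (c * t - c\<^sup>2 / 2)"
      unfolding std_normal_density_def by (simp only: exp_add mult.assoc)
    then show "ennreal (std_normal_density (t - c)) * indicator A t =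
        ennreal (std_normal_density t) * (ennreal (exp (c * t - c\<^sup>2 / 2)) * indicator A t)"
      by (simp add: ennreal_mult mult.assoc)
  qed
  also have "\<dots> = emeasure (density stdn (\<lambda>t. ennreal (exp (c * t - c\<^sup>2 / 2)))) A"
    by (subst emeasure_density) (simp_all add: nn_integral_density)
  finally show "emeasure (distr stdn stdn (\<lambda>t. t + c)) A =
      emeasure (density stdn (\<lambda>t. ennreal (exp (c * t - c\<^sup>2 / 2)))) A" .
qed simp

text \<open>Both sides equal the product of the shifted normals \<open>N i\<close>, which is
  determined by its values on boxes: for the image measure because the preimage of a box is a box,
  for the weighted measure because the exponential of a sum factors over the coordinates.\<close>

lemma gauss_shift:
  assumes I: "finite I"
  shows "distr (gauss I) (gauss I) (\<lambda>z. \<lambda>i\<in>I. z i + s i) =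
    density (gauss I) (\<lambda>z. ennreal (exp (\<Sum>i\<in>I. s i * z i - (s i)\<^sup>2 / 2)))"
    (is "?D = ?R")
proof -
  define N where "N i = distr stdn stdn (\<lambda>t. t + s i)" for i
  have N_sets [simp]: "sets (N i) = sets borel" for i by (simp add: N_def)
  have N_prob: "prob_space (N i)" for i
    unfolding N_def by (intro stdn.prob_space_distr) simp
  interpret N: product_sigma_finite N
    using N_prob by (auto simp: product_sigma_finite_def prob_space_imp_sigma_finite)
  have PN: "sets (PiM I N) = sets (gauss I)" by (rule sets_PiM_cong) auto
  have "?D = PiM I N"
  proof (rule N.PiM_eqI[OF I])
    show "sets ?D = sets (PiM I N)" by (simp add: PN)
    fix A assume A: "\<And>i. i \<in> I \<Longrightarrow> A i \<in> sets (N i)"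
    then have [measurable]: "Pi\<^sub>E I A \<in> sets (gauss I)"
      by (intro sets_PiM_I_finite I) auto
    have eq: "(\<lambda>z. \<lambda>i\<in>I. z i + s i) -` Pi\<^sub>E I A \<inter> space (gauss I) =
        Pi\<^sub>E I (\<lambda>i. (\<lambda>t. t + s i) -` A i)"
      by (auto simp: space_PiM PiE_iff)
    have B: "(\<lambda>t. t + s i) -` A i \<in> sets stdn" if "i \<in> I" for i
      using measurable_sets_borel[of "\<lambda>t. t + s i" borel "A i"] A[OF that] by simp
    have "emeasure ?D (Pi\<^sub>E I A) = emeasure (gauss I) (Pi\<^sub>E I (\<lambda>i. (\<lambda>t. t + s i) -` A i))"
      by (subst emeasure_distr) (simp_all add: eq)
    also have "\<dots> = (\<Prod>i\<in>I. emeasure stdn ((\<lambda>t. t + s i) -` A i))"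
      by (rule gauss.emeasure_PiM[OF I B])
    also have "\<dots> = (\<Prod>i\<in>I. emeasure (N i) (A i))"
      using A unfolding N_def by (intro prod.cong refl, subst emeasure_distr) auto
    finally show "emeasure ?D (Pi\<^sub>E I A) = (\<Prod>i\<in>I. emeasure (N i) (A i))" .
  qed
  also have "\<dots> = ?R"
  proof (rule N.PiM_eqI[OF I, symmetric])
    show "sets ?R = sets (PiM I N)" by (simp add: PN)
    fix A assume A: "\<And>i. i \<in> I \<Longrightarrow> A i \<in> sets (N i)"
    then have [measurable]: "Pi\<^sub>E I A \<in> sets (gauss I)"
      by (intro sets_PiM_I_finite I) auto
    have A' [measurable]: "i \<in> I \<Longrightarrow> A i \<in> sets borel" for i using A by simp
    have "emeasure ?R (Pi\<^sub>E I A) =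
        (\<integral>\<^sup>+z. ennreal (exp (\<Sum>i\<in>I. s i * z i - (s i)\<^sup>2 / 2)) * indicator (Pi\<^sub>E I A) z \<partial>gauss I)"
      by (rule emeasure_density) measurable
    also have "\<dots> = (\<integral>\<^sup>+z. (\<Prod>i\<in>I. ennreal (exp (s i * z i - (s i)\<^sup>2 / 2)) * indicator (A i) (z i)) \<partial>gauss I)"
    proof (intro nn_integral_cong)
      fix z assume z: "z \<in> space (gauss I)"
      have "indicator (Pi\<^sub>E I A) z = (\<Prod>i\<in>I. indicator (A i) (z i) :: ennreal)"
        using z I by (auto simp: indicator_def space_PiM PiE_iff prod_zero_iff)
      then show "ennreal (exp (\<Sum>i\<in>I. s i * z i - (s i)\<^sup>2 / 2)) * indicator (Pi\<^sub>E I A) z =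
        (\<Prod>i\<in>I. ennreal (exp (s i * z i - (s i)\<^sup>2 / 2)) * indicator (A i) (z i))"
        by (simp add: exp_sum I prod.distrib prod_ennreal)
    qed
    also have "\<dots> = (\<Prod>i\<in>I. \<integral>\<^sup>+t. ennreal (exp (s i * t - (s i)\<^sup>2 / 2)) * indicator (A i) t \<partial>stdn)"
      by (rule gauss.product_nn_integral_prod[OF I]) measurable
    also have "\<dots> = (\<Prod>i\<in>I. emeasure (N i) (A i))"
      unfolding N_def stdn_shift by (intro prod.cong refl, subst emeasure_density) auto
    finally show "emeasure ?R (Pi\<^sub>E I A) = (\<Prod>i\<in>I. emeasure (N i) (A i))" .
  qed
  finally show ?thesis .
qed

text \<open>The form in which the shift is used: translating the argument of \<open>f\<close> is
  traded for a weight on the measure. The equivalence of integrability lets one side be checked and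
  the other deduced.\<close>

lemma integral_gauss_shift:
  fixes f :: "('i \<Rightarrow> real) \<Rightarrow> real"
  assumes I: "finite I" and [measurable]: "f \<in> borel_measurable (gauss I)"
  shows "(\<integral>z. f (\<lambda>i\<in>I. z i + s i) \<partial>gauss I) =
      (\<integral>z. exp (\<Sum>i\<in>I. s i * z i - (s i)\<^sup>2 / 2) * f z \<partial>gauss I)"
    and "integrable (gauss I) (\<lambda>z. f (\<lambda>i\<in>I. z i + s i)) \<longleftrightarrow>
      integrable (gauss I) (\<lambda>z. exp (\<Sum>i\<in>I. s i * z i - (s i)\<^sup>2 / 2) * f z)"
proof -
  have T [measurable]: "(\<lambda>z. \<lambda>i\<in>I. z i + s i) \<in> measurable (gauss I) (gauss I)"
    by measurable
  show "(\<integral>z. f (\<lambda>i\<in>I. z i + s i) \<partial>gauss I) =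
      (\<integral>z. exp (\<Sum>i\<in>I. s i * z i - (s i)\<^sup>2 / 2) * f z \<partial>gauss I)"
    by (subst integral_distr[OF T, symmetric], simp, subst gauss_shift[OF I])
      (subst integral_real_density, auto)
  show "integrable (gauss I) (\<lambda>z. f (\<lambda>i\<in>I. z i + s i)) \<longleftrightarrow>
      integrable (gauss I) (\<lambda>z. exp (\<Sum>i\<in>I. s i * z i - (s i)\<^sup>2 / 2) * f z)"
    by (subst integrable_distr_eq[OF T, symmetric], simp, subst gauss_shift[OF I])
      (subst integrable_real_density, auto)
qed

lemma gauss_component:
  fixes h :: "real \<Rightarrow> real"
  assumes "i \<in> I" and [measurable]: "h \<in> borel_measurable borel"
  shows "integrable (gauss I) (\<lambda>z. h (z i)) \<longleftrightarrow> integrable stdn h"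
    and "(\<integral>z. h (z i) \<partial>gauss I) = (\<integral>t. h t \<partial>stdn)"
proof -
  have D: "distr (gauss I) stdn (\<lambda>z. z i) = stdn"
    using distr_PiM_component[of I "\<lambda>_. stdn" i] assms(1) stdn.prob_space_axioms by simp
  have T: "(\<lambda>z. z i) \<in> measurable (gauss I) stdn" using assms(1) by measurable
  show "integrable (gauss I) (\<lambda>z. h (z i)) \<longleftrightarrow> integrable stdn h"
    using integrable_distr_eq[OF T, of h] by (simp add: D)
  show "(\<integral>z. h (z i) \<partial>gauss I) = (\<integral>t. h t \<partial>stdn)"
    using integral_distr[OF T, of h] by (simp add: D)
qed

section \<open>Second moments of linear forms in a Gaussian vector\<close>

lemma gauss_covariance:
  assumes I: "finite I" and ij: "i \<in> I" "j \<in> I"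
  shows "integrable (gauss I) (\<lambda>z. z i * z j)"
    and "(\<integral>z. z i * z j \<partial>gauss I) = (if i = j then 1 else 0)"
proof -
  have "integrable (gauss I) (\<lambda>z. z i * z j) \<and>
    (\<integral>z. z i * z j \<partial>gauss I) = (if i = j then 1 else 0)"
  proof (cases "i = j")
    case True
    then show ?thesis
      using gauss_component[of i I "\<lambda>t. t\<^sup>2"] ij integrable_stdn_power[of 2] integral_stdn_2
      by (simp add: power2_eq_square)
  next
    case False
    \<comment> \<open>The product of two coordinates is written as a product over all of
      \<open>I\<close> with factor 1 elsewhere, so that its integral factors by independence; the
      factor at \<open>i\<close> is the mean 0.\<close>
    define g :: "_ \<Rightarrow> real \<Rightarrow> real" where "g k t = (if k = i \<or> k = j then t else 1)" for k t
    have int: "integrable stdn (g k)" for k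
    proof -
      have "g k = (if k = i \<or> k = j then (\<lambda>t. t) else (\<lambda>_. 1))" by (auto simp: g_def)
      then show ?thesis using integrable_stdn_power[of 1] by simp
    qed
    have eq: "(\<Prod>k\<in>I. g k (z k)) = z i * z j" for z
    proof -
      have "(\<Prod>k\<in>I. g k (z k)) = (\<Prod>k\<in>{i, j}. g k (z k))"
        using I ij by (intro prod.mono_neutral_right) (auto simp: g_def)
      then show ?thesis using False by (simp add: g_def)
    qed
    have "g i = (\<lambda>t. t)" by (auto simp: g_def)
    then have "integral\<^sup>L stdn (g i) = 0" using integral_stdn_1 by simp
    then have "(\<Prod>k\<in>I. integral\<^sup>L stdn (g k)) = 0"
      using I ij(1) by (intro prod_zero) auto
    then show ?thesis
      using gauss.product_integral_prod[OF I, of g] gauss.product_integrable_prod[OF I, of g] int False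
      by (simp add: eq)
  qed
  then show "integrable (gauss I) (\<lambda>z. z i * z j)"
    "(\<integral>z. z i * z j \<partial>gauss I) = (if i = j then 1 else 0)" by auto
qed

lemma gauss_linear_square:
  assumes I: "finite I"
  shows "integrable (gauss I) (\<lambda>z. (\<Sum>i\<in>I. s i * z i)\<^sup>2)"
    and "(\<integral>z. (\<Sum>i\<in>I. s i * z i)\<^sup>2 \<partial>gauss I) = (\<Sum>i\<in>I. (s i)\<^sup>2)"
proof -
  have eq: "(\<Sum>i\<in>I. s i * z i)\<^sup>2 = (\<Sum>i\<in>I. \<Sum>j\<in>I. s i * s j * (z i * z j))" for z :: "_ \<Rightarrow> real"
    by (simp add: power2_eq_square sum_product mult_ac)
  show "integrable (gauss I) (\<lambda>z. (\<Sum>i\<in>I. s i * z i)\<^sup>2)"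
    unfolding eq by (intro Bochner_Integration.integrable_sum integrable_mult_right gauss_covariance I)
  have "(\<integral>z. (\<Sum>i\<in>I. s i * z i)\<^sup>2 \<partial>gauss I) =
      (\<Sum>i\<in>I. \<Sum>j\<in>I. s i * s j * (if i = j then 1 else 0))"
    unfolding eq by (simp add: Bochner_Integration.integral_sum gauss_covariance I
        Bochner_Integration.integrable_sum integrable_mult_right)
  also have "\<dots> = (\<Sum>i\<in>I. (s i)\<^sup>2)"
    using I by (simp add: power2_eq_square if_distrib sum.delta cong: if_cong)
  finally show "(\<integral>z. (\<Sum>i\<in>I. s i * z i)\<^sup>2 \<partial>gauss I) = (\<Sum>i\<in>I. (s i)\<^sup>2)" .
qed

lemma prob_space_gauss: "prob_space (gauss I)"
  by (intro prob_space_PiM stdn.prob_space_axioms)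

lemma measure_space_gauss: "measure (gauss I) (space (gauss I)) = 1"
  by (rule prob_space.prob_space[OF prob_space_gauss])

lemma gauss_linear:
  assumes I: "finite I"
  shows "integrable (gauss I) (\<lambda>z. \<Sum>i\<in>I. s i * z i)"
    and "(\<integral>z. (\<Sum>i\<in>I. s i * z i) \<partial>gauss I) = 0"
proof -
  have *: "i \<in> I \<Longrightarrow> integrable (gauss I) (\<lambda>z. z i)" "i \<in> I \<Longrightarrow> (\<integral>z. z i \<partial>gauss I) = 0" for i
    using gauss_component[of i I "\<lambda>t. t"] integrable_stdn_power[of 1] integral_stdn_1 by auto
  show "integrable (gauss I) (\<lambda>z. \<Sum>i\<in>I. s i * z i)"
    using * by (intro Bochner_Integration.integrable_sum integrable_mult_right)
  show "(\<integral>z. (\<Sum>i\<in>I. s i * z i) \<partial>gauss I) = 0"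
    using * by (simp add: Bochner_Integration.integral_sum)
qed

text \<open>\<open>R\<close> is the Cameron-Martin weight minus its first-order part. Since
  \<open>exp \<sigma> - 1 - \<sigma>\<close> starts at second order in \<sigma>, linearising the
  weight costs, in the L2 norm, an error quadratic in the shift.\<close>

lemma gauss_exp_remainder:
  fixes s :: "'i \<Rightarrow> real"
  assumes I: "finite I"
  defines "R \<equiv> \<lambda>z. exp (\<Sum>i\<in>I. s i * z i - (s i)\<^sup>2 / 2) - 1 - (\<Sum>i\<in>I. s i * z i)"
  defines "\<sigma> \<equiv> \<Sum>i\<in>I. (s i)\<^sup>2"
  shows "integrable (gauss I) (\<lambda>z. (R z)\<^sup>2)"
    and "(\<integral>z. (R z)\<^sup>2 \<partial>gauss I) = exp \<sigma> - 1 - \<sigma>"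
proof -
  define E where "E z = exp (\<Sum>i\<in>I. s i * z i - (s i)\<^sup>2 / 2)" for z
  define l where "l z = (\<Sum>i\<in>I. s i * z i)" for z
  have [measurable]: "E \<in> borel_measurable (gauss I)" "l \<in> borel_measurable (gauss I)"
    unfolding E_def[abs_def] l_def[abs_def] by measurable
  have l_shift: "l (\<lambda>i\<in>I. z i + s i) = l z + \<sigma>" for z
    by (simp add: l_def \<sigma>_def algebra_simps power2_eq_square sum.distrib)
  have E_eq: "E z = exp (l z - \<sigma> / 2)" for z
    by (simp add: E_def l_def \<sigma>_def sum_subtractf sum_divide_distrib)
  have E_shift: "E (\<lambda>i\<in>I. z i + s i) = exp \<sigma> * E z" for z
    by (simp add: E_eq l_shift exp_add[symmetric])
  note l = gauss_linear[OF I, of s, folded l_def]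
  note l2 = gauss_linear_square[OF I, of s, folded l_def, folded \<sigma>_def]
  \<comment> \<open>Moments against the weight \<open>E\<close> are plain moments after the shift,
    under which \<open>l\<close> gains the constant \<sigma> and \<open>E\<close> the factor
    \<open>exp \<sigma>\<close>. Hence \<open>E\<close>, \<open>E * l\<close> and
    \<open>E * E\<close> have means 1, \<sigma> and \<open>exp \<sigma>\<close>.\<close>
  note sh = integral_gauss_shift[OF I, of _ s, folded E_def]
  have E1: "integrable (gauss I) E" "(\<integral>z. E z \<partial>gauss I) = 1"
    using sh[of "\<lambda>_. 1"] by (auto simp: measure_space_gauss)
  have El: "integrable (gauss I) (\<lambda>z. E z * l z)" "(\<integral>z. E z * l z \<partial>gauss I) = \<sigma>"
    using sh[of l] l by (auto simp: measure_space_gauss l_shift)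
  have expect_it: "integrable (gauss I) (\<lambda>z. E z * E z)" "(\<integral>z. E z * E z \<partial>gauss I) = exp \<sigma>"
    using sh[of E] E1 by (auto simp: E_shift)
  have eq: "(R z)\<^sup>2 = E z * E z - 2 * E z - 2 * (E z * l z) + 1 + 2 * l z + (l z)\<^sup>2" for z
  proof -
    have "R z = E z - 1 - l z" by (simp add: R_def E_def l_def)
    show ?thesis unfolding \<open>R z = E z - 1 - l z\<close> by (simp add: power2_eq_square algebra_simps)
  qed
  show "integrable (gauss I) (\<lambda>z. (R z)\<^sup>2)"
    unfolding eq using E1 El expect_it l l2 by simp
  show "(\<integral>z. (R z)\<^sup>2 \<partial>gauss I) = exp \<sigma> - 1 - \<sigma>"
    unfolding eq using E1 El expect_it l l2 by (simp add: measure_space_gauss)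
qed

section \<open>Vectors and gradients\<close>

lemma vnorm_le_sum_abs: "vnorm n w \<le> (\<Sum>i<n. \<bar>w i\<bar>)"
  by (simp add: vnorm_def L2_set_le_sum_abs)

lemma vnorm_nonneg [simp]: "0 \<le> vnorm n w"
  by (simp add: vnorm_def)

lemma vnorm_sq: "(vnorm n w)\<^sup>2 = (\<Sum>i<n. (w i)\<^sup>2)"
  by (simp add: vnorm_def L2_set_def sum_nonneg)

lemma vnorm_scale: "vnorm n (\<lambda>i. c * v i) = \<bar>c\<bar> * vnorm n v"
  unfolding vnorm_def L2_set_def
  by (simp add: power_mult_distrib sum_distrib_left[symmetric] real_sqrt_mult)

lemma abs_le_vnorm: "i < n \<Longrightarrow> \<bar>v i\<bar> \<le> vnorm n v"
  unfolding vnorm_def using member_le_L2_set[of "{..<n}" i "\<lambda>i. \<bar>v i\<bar>"] by (simp add: L2_set_def)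

lemma Rn_add: "w \<in> Rn n \<Longrightarrow> v \<in> Rn n \<Longrightarrow> (\<lambda>i. w i + c * v i) \<in> Rn n"
  by (simp add: Rn_def)

text \<open>Makes the definite description in \<open>gradient\<close> meaningful. For an increment
  \<open>t\<close> in the i-th coordinate direction the two linear terms differ by
  \<open>\<bar>D i - D' i\<bar> * t\<close>, and the two error bounds together force this below
  \<open>e * t\<close>.\<close>

lemma has_gradient_unique:
  assumes D: "has_gradient n g D w" and D': "has_gradient n g D' w" and w: "w \<in> Rn n"
  shows "D = D'"
proof
  fix i
  show "D i = D' i"
  proof (cases "i < n")
    case False
    then show ?thesis using D D' by (simp add: has_gradient_def Rn_def)
  next
    case True
    have "\<bar>D i - D' i\<bar> \<le> 0 + e" if "e > 0" for e
    proof -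
      have e2: "e / 2 > 0" using that by simp
      from D e2 obtain d where d: "d > 0" "\<And>v. v \<in> Rn n \<Longrightarrow> vnorm n (\<lambda>i. v i - w i) < d \<Longrightarrow>
        \<bar>g v - g w - vinner n D (\<lambda>i. v i - w i)\<bar> \<le> e / 2 * vnorm n (\<lambda>i. v i - w i)"
        unfolding has_gradient_def by meson
      from D' e2 obtain d' where d': "d' > 0" "\<And>v. v \<in> Rn n \<Longrightarrow> vnorm n (\<lambda>i. v i - w i) < d' \<Longrightarrow>
        \<bar>g v - g w - vinner n D' (\<lambda>i. v i - w i)\<bar> \<le> e / 2 * vnorm n (\<lambda>i. v i - w i)"
        unfolding has_gradient_def by meson
      define t where "t = min d d' / 2"
      have t: "0 < t" "t < d" "t < d'" using d(1) d'(1) by (auto simp: t_def)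
      define v where "v = w(i := w i + t)"
      have vw: "v j - w j = (if j = i then t else 0)" for j by (simp add: v_def)
      have v: "v \<in> Rn n" using w True by (auto simp: v_def Rn_def)
      have nv: "vnorm n (\<lambda>i. v i - w i) = t"
        using True t by (simp add: vw vnorm_def L2_set_def if_distrib[of "\<lambda>x. x\<^sup>2"] cong: if_cong)
      have iv: "vinner n E (\<lambda>i. v i - w i) = E i * t" for E
        using True by (simp add: vinner_def vw if_distrib cong: if_cong)
      have "\<bar>D i * t - D' i * t\<bar> \<le> e * t"
        using d(2)[OF v] d'(2)[OF v] t unfolding nv iv by linarith
      then have "\<bar>D i - D' i\<bar> * t \<le> e * t"
        using t by (simp add: abs_mult left_diff_distrib[symmetric])
      then show ?thesis using t by simp
    qed
    then have "\<bar>D i - D' i\<bar> \<le> 0" by (rule field_le_epsilon)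
    then show ?thesis by simp
  qed
qed

lemma gradient_eqI: "has_gradient n g D w \<Longrightarrow> w \<in> Rn n \<Longrightarrow> gradient n g w = D"
  unfolding gradient_def by (rule the_equality) (auto dest: has_gradient_unique)

text \<open>Reduces the gradient to an ordinary derivative along a line, so that the one-dimensional
  mean value theorem becomes available.\<close>

lemma has_gradient_line:
  assumes g: "has_gradient n g D (\<lambda>i. w i + t * v i)" and w: "w \<in> Rn n" and v: "v \<in> Rn n"
  shows "((\<lambda>t. g (\<lambda>i. w i + t * v i)) has_real_derivative vinner n D v) (at t)"
  unfolding has_field_derivative_def has_derivative_at_alt
proof (intro conjI allI impI)
  show "bounded_linear ((*) (vinner n D v))" by (rule bounded_linear_mult_right)
  fix e :: real assume e: "0 < e"
  \<comment> \<open>Adding 1 keeps the scaling factor positive when the direction \<open>v\<close>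
    is zero.\<close>
  let ?c = "vnorm n v + 1"
  have c: "?c > 0" by (simp add: add_nonneg_pos)
  then have ec: "e / ?c > 0" using e by simp
  have line: "(\<lambda>i. w i + y * v i - (w i + t * v i)) = (\<lambda>i. (y - t) * v i)" for y
    by (auto simp: algebra_simps)
  have iv: "vinner n D (\<lambda>i. a * v i) = a * vinner n D v" for a
    by (simp add: vinner_def sum_distrib_left mult_ac)
  from g ec obtain d where d: "d > 0"
    "\<And>y. y \<in> Rn n \<Longrightarrow> vnorm n (\<lambda>i. y i - (w i + t * v i)) < d \<Longrightarrow>
      \<bar>g y - g (\<lambda>i. w i + t * v i) - vinner n D (\<lambda>i. y i - (w i + t * v i))\<bar>
        \<le> e / ?c * vnorm n (\<lambda>i. y i - (w i + t * v i))"
    unfolding has_gradient_def by meson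
  show "\<exists>d>0. \<forall>y. norm (y - t) < d \<longrightarrow>
    norm (g (\<lambda>i. w i + y * v i) - g (\<lambda>i. w i + t * v i) - vinner n D v * (y - t)) \<le> e * norm (y - t)"
  proof (intro exI[of _ "d / ?c"] conjI allI impI)
    show "d / ?c > 0" using d c by simp
    fix y assume y: "norm (y - t) < d / ?c"
    have R: "(\<lambda>i. w i + y * v i) \<in> Rn n" using w v by (auto simp: Rn_def)
    have "\<bar>y - t\<bar> * vnorm n v \<le> \<bar>y - t\<bar> * ?c" by (intro mult_left_mono) auto
    moreover have "\<bar>y - t\<bar> * ?c < d" using y c by (simp add: pos_less_divide_eq)
    ultimately have "\<bar>y - t\<bar> * vnorm n v < d" by linarith
    from d(2)[OF R, unfolded line vnorm_scale iv, OF this]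
    have "\<bar>g (\<lambda>i. w i + y * v i) - g (\<lambda>i. w i + t * v i) - (y - t) * vinner n D v\<bar>
      \<le> e / ?c * (\<bar>y - t\<bar> * vnorm n v)" .
    also have "\<dots> \<le> e / ?c * (\<bar>y - t\<bar> * ?c)"
      using ec by (intro mult_left_mono) auto
    also have "\<dots> = e * \<bar>y - t\<bar>" using c by simp
    finally show "norm (g (\<lambda>i. w i + y * v i) - g (\<lambda>i. w i + t * v i) - vinner n D v * (y - t))
      \<le> e * norm (y - t)"
      by (simp add: mult.commute)
  qed
qed

text \<open>A function measurable in \<open>z\<close> and Lipschitz in \<open>w\<close> stays
  measurable when a random point is inserted for \<open>w\<close>. The point \<open>W z\<close> is
  rounded down to a grid of mesh \<open>1 / Suc m\<close>; the rounded point takes countably many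
  values, so the composition is measurable, and Lipschitz continuity gives pointwise convergence as
  \<open>m\<close> grows.\<close>

lemma borel_measurable_lipschitz_comp:
  fixes G :: "vec \<Rightarrow> 'z \<Rightarrow> real"
  assumes G: "\<And>w. w \<in> Rn n \<Longrightarrow> G w \<in> borel_measurable P"
    and lip: "\<And>z. z \<in> space P \<Longrightarrow> lipschitz_Rn n K (\<lambda>w. G w z)"
    and W: "\<And>i. i < n \<Longrightarrow> (\<lambda>z. W z i) \<in> borel_measurable P"
    and Rn: "\<And>z. z \<in> space P \<Longrightarrow> W z \<in> Rn n"
  shows "(\<lambda>z. G (W z) z) \<in> borel_measurable P"
proof -
  define D where "D m c = (\<lambda>i. if i < n then real_of_int (c i) / real (Suc m) else 0)"
    for m and c :: "nat \<Rightarrow> int"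
  define g where "g m z = (\<lambda>i\<in>{..<n}. \<lfloor>real (Suc m) * W z i\<rfloor>)" for m z
  have D_Rn: "D m c \<in> Rn n" for m c by (auto simp: D_def Rn_def)
  have meas: "(\<lambda>z. G (D m (g m z)) z) \<in> borel_measurable P" for m
  proof (rule measurable_compose_countable'[where I = "{..<n} \<rightarrow>\<^sub>E (UNIV :: int set)"])
    show "countable ({..<n} \<rightarrow>\<^sub>E (UNIV :: int set))"
      by (rule countable_PiE) auto
    then show "g m \<in> measurable P (count_space ({..<n} \<rightarrow>\<^sub>E (UNIV :: int set)))"
    proof (subst measurable_count_space_eq_countable, assumption, intro conjI ballI)
      fix c :: "nat \<Rightarrow> int" assume c: "c \<in> {..<n} \<rightarrow>\<^sub>E UNIV"
      have "g m -` {c} \<inter> space P = {z \<in> space P. \<forall>i\<in>{..<n}. \<lfloor>real (Suc m) * W z i\<rfloor> = c i}"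
        using c by (auto simp: g_def PiE_iff extensional_def fun_eq_iff)
      also have "\<dots> \<in> sets P"
      proof (rule sets.sets_Collect_finite_All)
        fix i assume "i \<in> {..<n}"
        then have [measurable]: "(\<lambda>z. W z i) \<in> borel_measurable P" using W by simp
        show "{z \<in> space P. \<lfloor>real (Suc m) * W z i\<rfloor> = c i} \<in> sets P" by measurable
      qed simp
      finally show "g m -` {c} \<inter> space P \<in> sets P" .
    qed (auto simp: g_def)
  qed (rule G[OF D_Rn])
  show ?thesis
  proof (rule borel_measurable_LIMSEQ_real[OF _ meas])
    fix z assume z: "z \<in> space P"
    have bd: "norm (G (D m (g m z)) z - G (W z) z) \<le> (\<bar>K\<bar> * real n) * inverse (real (Suc m))" for m
    proof -
      have c: "\<bar>D m (g m z) i - W z i\<bar> \<le> inverse (real (Suc m))" if "i < n" for i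
      proof -
        let ?a = "real (Suc m) * W z i"
        have "D m (g m z) i - W z i = (of_int \<lfloor>?a\<rfloor> - ?a) / real (Suc m)"
          using that by (simp add: D_def g_def field_simps del: of_nat_Suc)
        moreover have "\<bar>of_int \<lfloor>?a\<rfloor> - ?a\<bar> \<le> 1" by linarith
        ultimately show ?thesis
          by (simp add: abs_divide divide_right_mono inverse_eq_divide del: of_nat_Suc)
      qed
      have "norm (G (D m (g m z)) z - G (W z) z) \<le> K * vnorm n (\<lambda>i. D m (g m z) i - W z i)"
        using lip[OF z] D_Rn Rn[OF z] by (simp add: lipschitz_Rn_def)
      also have "\<dots> \<le> \<bar>K\<bar> * (\<Sum>i<n. \<bar>D m (g m z) i - W z i\<bar>)"
        by (intro mult_mono vnorm_le_sum_abs) auto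
      also have "\<dots> \<le> \<bar>K\<bar> * (\<Sum>i<n. inverse (real (Suc m)))"
        using c by (intro mult_left_mono sum_mono) auto
      finally show ?thesis by simp
    qed
    have "(\<lambda>m. G (D m (g m z)) z - G (W z) z) \<longlonglongrightarrow> 0"
      by (rule Lim_null_comparison[OF always_eventually tendsto_mult_right_zero[OF LIMSEQ_inverse_real_of_nat]])
        (use bd in auto)
    then show "(\<lambda>m. G (D m (g m z)) z) \<longlonglongrightarrow> G (W z) z"
      by (simp add: LIM_zero_iff)
  qed
qed

lemma abs_mult_le_squares: "2 * \<bar>a * b\<bar> \<le> a\<^sup>2 + b\<^sup>2" for a b :: real
  using zero_le_power2[of "\<bar>a\<bar> - \<bar>b\<bar>"] by (simp add: power2_diff abs_mult)

lemma gauss_square: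
  assumes "i \<in> I"
  shows "integrable (gauss I) (\<lambda>z. (z i)\<^sup>2)" "(\<integral>z. (z i)\<^sup>2 \<partial>gauss I) = 1"
  using gauss_component[OF assms, of "\<lambda>t. t\<^sup>2"] integrable_stdn_power[of 2] integral_stdn_2 by auto

text \<open>
  By Cameron--Martin, shifting the argument of the smoothed function by \<open>v\<close> reweights the Gaussian
  by \<open>exp (\<langle>s, z\<rangle> - \<parallel>s\<parallel>\<^sup>2 / 2)\<close> with \<open>s = v / \<mu>\<close> on \<open>A\<close>; the linear part of this weight produces
  the gradient estimator, and the remainder is quadratic in \<open>s\<close> in the \<open>L\<^sup>2\<close> sense.
\<close>

lemma gauss_smoothing_expansion:
  fixes g :: "vec \<Rightarrow> real"
  assumes A: "A \<subseteq> {..<n}" and K: "0 \<le> K" and \<mu>: "0 < \<mu>"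
    and lip: "\<And>w w'. w \<in> Rn n \<Longrightarrow> w' \<in> Rn n \<Longrightarrow>
      \<bar>g w - g w'\<bar> \<le> K * sqrt (\<Sum>i\<in>A. (w i - w' i)\<^sup>2)"
    and w: "w \<in> Rn n" and v: "v \<in> Rn n" and small: "(\<Sum>i<n. (v i)\<^sup>2) \<le> \<mu>\<^sup>2"
  defines "r \<equiv> \<lambda>z i. if i \<in> A then z i else (0 :: real)"
  shows "\<bar>\<integral>z. g (\<lambda>i. w i + v i + \<mu> * r z i) - g (\<lambda>i. w i + \<mu> * r z i)
      - (\<Sum>i<n. v i * ((g (\<lambda>i. w i + \<mu> * r z i) - g w) / \<mu> * r z i)) \<partial>gauss {..<n}\<bar>
    \<le> K * (real n + 1) / \<mu> * (\<Sum>i<n. (v i)\<^sup>2)"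
proof -
  let ?P = "gauss {..<n}"
  \<comment> \<open>Subtracting \<open>g w\<close> makes the integrand as small as
    \<open>K * \<mu> * sqrt (q z)\<close>; the same constant in \<open>h'\<close> cancels in the
    difference.\<close>
  define h where "h z = g (\<lambda>i. w i + \<mu> * r z i) - g w" for z
  define h' where "h' z = g (\<lambda>i. w i + v i + \<mu> * r z i) - g w" for z
  \<comment> \<open>The shift acts on the coordinates in \<open>A\<close> only: \<open>g\<close>
    does not see the others, because the seminorm in \<open>lip\<close> vanishes on them.\<close>
  define s where "s i = (if i \<in> A then v i / \<mu> else 0)" for i
  define \<sigma> where "\<sigma> = (\<Sum>i<n. (s i)\<^sup>2)"
  define E where "E z = exp (\<Sum>i<n. s i * z i - (s i)\<^sup>2 / 2)" for z
  define l where "l z = (\<Sum>i<n. s i * z i)" for z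
  define R where "R z = E z - 1 - l z" for z
  define q where "q z = (\<Sum>i<n. (z i)\<^sup>2)" for z :: vec
  have finA: "finite A" using A finite_subset by blast
  have r_Rn: "r z \<in> Rn n" for z using A by (auto simp: r_def Rn_def)
  have Rn1: "(\<lambda>i. w i + \<mu> * r z i) \<in> Rn n" for z using w r_Rn[of z] by (auto simp: Rn_def)
  have Rn2: "(\<lambda>i. w i + v i + \<mu> * r z i) \<in> Rn n" for z using w v r_Rn[of z] by (auto simp: Rn_def)
  have Rn3: "(\<lambda>i. w i + v i) \<in> Rn n" using w v by (auto simp: Rn_def)
  have lip': "lipschitz_Rn n K g"
    unfolding lipschitz_Rn_def
  proof (intro ballI)
    fix w w' assume W: "w \<in> Rn n" "w' \<in> Rn n"
    have "sqrt (\<Sum>i\<in>A. (w i - w' i)\<^sup>2) \<le> vnorm n (\<lambda>i. w i - w' i)"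
      unfolding vnorm_def L2_set_def using A by (intro real_sqrt_le_mono sum_mono2) auto
    then show "\<bar>g w - g w'\<bar> \<le> K * vnorm n (\<lambda>i. w i - w' i)"
      using lip[OF W] K by (meson mult_left_mono order_trans)
  qed
  have r_meas: "(\<lambda>z. r z i) \<in> borel_measurable ?P" if "i < n" for i
    using that by (cases "i \<in> A") (auto simp: r_def)
  have g_meas: "(\<lambda>z. g (W z)) \<in> borel_measurable ?P"
    if "\<And>i. i < n \<Longrightarrow> (\<lambda>z. W z i) \<in> borel_measurable ?P" "\<And>z. W z \<in> Rn n" for W
    by (rule borel_measurable_lipschitz_comp[of n "\<lambda>w _. g w" ?P K W]) (use lip' that in auto)
  have "(\<lambda>z. g (\<lambda>i. w i + \<mu> * r z i)) \<in> borel_measurable ?P"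
    using r_meas Rn1 by (intro g_meas) auto
  then have [measurable]: "h \<in> borel_measurable ?P"
    unfolding h_def[abs_def] by (rule borel_measurable_diff) simp
  have "(\<lambda>z. g (\<lambda>i. w i + v i + \<mu> * r z i)) \<in> borel_measurable ?P"
    using r_meas Rn2 by (intro g_meas) auto
  then have [measurable]: "h' \<in> borel_measurable ?P"
    unfolding h'_def[abs_def] by (rule borel_measurable_diff) simp
  have [measurable]: "E \<in> borel_measurable ?P" "l \<in> borel_measurable ?P" "q \<in> borel_measurable ?P"
    unfolding E_def[abs_def] l_def[abs_def] q_def[abs_def] by measurable
  have q: "integrable ?P q" "(\<integral>z. q z \<partial>?P) = real n"
    unfolding q_def[abs_def]
    by (auto intro!: Bochner_Integration.integrable_sum simp: Bochner_Integration.integral_sum gauss_square)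
  have rq: "sqrt (\<Sum>i\<in>A. (\<mu> * r z i)\<^sup>2) \<le> \<mu> * sqrt (q z)" for z
  proof -
    have "(\<Sum>i\<in>A. (\<mu> * r z i)\<^sup>2) = \<mu>\<^sup>2 * (\<Sum>i\<in>A. (z i)\<^sup>2)"
      by (simp add: r_def power_mult_distrib sum_distrib_left)
    also have "\<dots> \<le> \<mu>\<^sup>2 * q z"
      unfolding q_def using A by (intro mult_left_mono sum_mono2) auto
    finally have "sqrt (\<Sum>i\<in>A. (\<mu> * r z i)\<^sup>2) \<le> sqrt (\<mu>\<^sup>2 * q z)"
      by (rule real_sqrt_le_mono)
    then show ?thesis using \<mu> by (simp add: real_sqrt_mult)
  qed
  have q0: "0 \<le> q z" for z by (simp add: q_def sum_nonneg)
  have h_bd: "\<bar>h z\<bar> \<le> K * \<mu> * sqrt (q z)" for z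
  proof -
    have "\<bar>h z\<bar> \<le> K * sqrt (\<Sum>i\<in>A. (\<mu> * r z i)\<^sup>2)"
      using lip[OF Rn1 w, of z] by (simp add: h_def)
    also have "\<dots> \<le> K * (\<mu> * sqrt (q z))" using rq K by (intro mult_left_mono)
    finally show ?thesis by simp
  qed
  have h2_bd: "(h z)\<^sup>2 \<le> (K * \<mu>)\<^sup>2 * q z" for z
    using power_mono[OF h_bd[of z], of 2] q0[of z] by (simp add: power_mult_distrib)
  have h'_bd: "\<bar>h' z\<bar> \<le> 1 + (K * \<mu>)\<^sup>2 * q z + \<bar>g (\<lambda>i. w i + v i) - g w\<bar>" for z
  proof -
    have "\<bar>g (\<lambda>i. w i + v i + \<mu> * r z i) - g (\<lambda>i. w i + v i)\<bar> \<le> K * sqrt (\<Sum>i\<in>A. (\<mu> * r z i)\<^sup>2)"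
      using lip[OF Rn2 Rn3, of z] by simp
    also have "\<dots> \<le> K * (\<mu> * sqrt (q z))" using rq K by (intro mult_left_mono)
    \<comment> \<open>The square root is traded for its square plus 1, because the integrability of
      \<open>q\<close> is at hand.\<close>
    also have "\<dots> \<le> 1 + (K * \<mu> * sqrt (q z))\<^sup>2"
      using zero_le_power2[of "K * (\<mu> * sqrt (q z)) - 1"] zero_le_power2[of "K * (\<mu> * sqrt (q z))"]
      by (simp add: power2_eq_square algebra_simps)
    also have "\<dots> = 1 + (K * \<mu>)\<^sup>2 * q z" using q0[of z] by (simp add: power_mult_distrib)
    finally show ?thesis unfolding h'_def by linarith
  qed
  have ih': "integrable ?P h'"
  proof (rule Bochner_Integration.integrable_bound)
    show "integrable ?P (\<lambda>z. 1 + (K * \<mu>)\<^sup>2 * q z + \<bar>g (\<lambda>i. w i + v i) - g w\<bar>)"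
      using q(1) by simp
    show "AE z in ?P. norm (h' z) \<le> norm (1 + (K * \<mu>)\<^sup>2 * q z + \<bar>g (\<lambda>i. w i + v i) - g w\<bar>)"
      unfolding real_norm_def by (intro AE_I2 order_trans[OF h'_bd abs_ge_self])
  qed simp
  have ih2: "integrable ?P (\<lambda>z. (h z)\<^sup>2)"
  proof (rule Bochner_Integration.integrable_bound)
    show "integrable ?P (\<lambda>z. (K * \<mu>)\<^sup>2 * q z)" using q(1) by simp
    show "AE z in ?P. norm ((h z)\<^sup>2) \<le> norm ((K * \<mu>)\<^sup>2 * q z)"
      unfolding real_norm_def abs_power2 by (intro AE_I2 order_trans[OF h2_bd abs_ge_self])
  qed simp
  have ih: "integrable ?P h"
  proof (rule Bochner_Integration.integrable_bound[of _ "\<lambda>z. 1 + (h z)\<^sup>2"])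
    have "\<bar>a\<bar> \<le> 1 + a\<^sup>2" for a :: real
      using zero_le_power2[of "\<bar>a\<bar> - 1"] zero_le_power2[of a]
      by (simp add: power2_diff)
    then show "AE z in ?P. norm (h z) \<le> norm (1 + (h z)\<^sup>2)" by auto
  qed (use ih2 in auto)
  note l2 = gauss_linear_square[of "{..<n}" s, folded l_def, simplified]
  note R2 = gauss_exp_remainder[of "{..<n}" s, folded E_def l_def \<sigma>_def, folded R_def, simplified]
  \<comment> \<open>On \<open>A\<close>, translating \<open>z\<close> by \<open>v / \<mu>\<close>
    moves the argument of \<open>g\<close> by exactly \<open>v\<close>; off \<open>A\<close> the
    arguments may differ, but their distance in the seminorm is 0.\<close>
  have shift: "h (\<lambda>i\<in>{..<n}. z i + s i) = h' z" for z
  proof -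
    have "(\<lambda>i. w i + \<mu> * r (\<lambda>i\<in>{..<n}. z i + s i) i) \<in> Rn n" by (rule Rn1)
    from lip[OF this Rn2, of z] have
      "\<bar>h (\<lambda>i\<in>{..<n}. z i + s i) - h' z\<bar>
        \<le> K * sqrt (\<Sum>i\<in>A. (w i + \<mu> * r (\<lambda>i\<in>{..<n}. z i + s i) i - (w i + v i + \<mu> * r z i))\<^sup>2)"
      by (simp add: h_def h'_def)
    also have "(\<Sum>i\<in>A. (w i + \<mu> * r (\<lambda>i\<in>{..<n}. z i + s i) i - (w i + v i + \<mu> * r z i))\<^sup>2) = 0"
      using A \<mu> by (intro sum.neutral) (auto simp: r_def s_def subset_eq algebra_simps)
    finally have "\<bar>h (\<lambda>i\<in>{..<n}. z i + s i) - h' z\<bar> \<le> 0"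
      by (simp only: real_sqrt_zero mult_zero_right)
    then show ?thesis by linarith
  qed
  note sh = integral_gauss_shift[of "{..<n}" h s, folded E_def, unfolded shift]
  have iEh: "integrable ?P (\<lambda>z. E z * h z)" "(\<integral>z. h' z \<partial>?P) = (\<integral>z. E z * h z \<partial>?P)"
    using sh ih' by auto
  have ihl: "integrable ?P (\<lambda>z. l z * h z)"
  proof (rule Bochner_Integration.integrable_bound[of _ "\<lambda>z. (l z)\<^sup>2 + (h z)\<^sup>2"])
    have "\<bar>a * b\<bar> \<le> a\<^sup>2 + b\<^sup>2" for a b :: real
      using abs_mult_le_squares[of a b] abs_ge_zero[of "a * b"] by linarith
    then show "AE z in ?P. norm (l z * h z) \<le> norm ((l z)\<^sup>2 + (h z)\<^sup>2)" by auto
  qed (use ih2 l2 in auto)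
  have iRh: "integrable ?P (\<lambda>z. R z * h z)"
    unfolding R_def using iEh(1) ih ihl by (simp add: left_diff_distrib)
  have "(\<integral>z. g (\<lambda>i. w i + v i + \<mu> * r z i) - g (\<lambda>i. w i + \<mu> * r z i)
      - (\<Sum>i<n. v i * ((g (\<lambda>i. w i + \<mu> * r z i) - g w) / \<mu> * r z i)) \<partial>?P)
      = (\<integral>z. h' z - h z - l z * h z \<partial>?P)"
  proof (intro Bochner_Integration.integral_cong refl)
    fix z :: vec
    have "(\<Sum>i<n. v i * (h z / \<mu> * r z i)) = l z * h z"
      unfolding l_def sum_distrib_right by (intro sum.cong) (auto simp: r_def s_def)
    then show "g (\<lambda>i. w i + v i + \<mu> * r z i) - g (\<lambda>i. w i + \<mu> * r z i)
      - (\<Sum>i<n. v i * ((g (\<lambda>i. w i + \<mu> * r z i) - g w) / \<mu> * r z i)) = h' z - h z - l z * h z"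
      by (simp add: h_def h'_def)
  qed
  also have "\<dots> = (\<integral>z. R z * h z \<partial>?P)"
    using ih' ih ihl iEh by (simp add: R_def left_diff_distrib)
  finally have eq: "(\<integral>z. g (\<lambda>i. w i + v i + \<mu> * r z i) - g (\<lambda>i. w i + \<mu> * r z i)
      - (\<Sum>i<n. v i * ((g (\<lambda>i. w i + \<mu> * r z i) - g w) / \<mu> * r z i)) \<partial>?P)
      = (\<integral>z. R z * h z \<partial>?P)" .
  have \<sigma>0: "0 \<le> \<sigma>" by (simp add: \<sigma>_def sum_nonneg)
  have \<sigma>v: "\<mu>\<^sup>2 * \<sigma> \<le> (\<Sum>i<n. (v i)\<^sup>2)"
    unfolding \<sigma>_def sum_distrib_left using \<mu>
    by (intro sum_mono) (auto simp: s_def power_divide)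
  \<comment> \<open>This is where the smallness of \<open>v\<close> enters: \<sigma> at most 1 is
    what \<open>exp_bound\<close> requires.\<close>
  have \<sigma>1: "\<sigma> \<le> 1"
  proof -
    have "\<mu>\<^sup>2 * \<sigma> \<le> \<mu>\<^sup>2 * 1" using \<sigma>v small by linarith
    then show ?thesis using \<mu> by (simp add: mult_le_cancel_left_pos del: mult_1_right)
  qed
  have "\<bar>\<integral>z. R z * h z \<partial>?P\<bar> \<le> K * \<mu> * (\<sigma> * (real n + 1))"
  proof (cases "\<sigma> = 0")
    case True
    then have "\<forall>i<n. s i = 0" by (simp add: \<sigma>_def sum_nonneg_eq_0_iff)
    then have "R z = 0" for z by (simp add: R_def E_def l_def)
    then show ?thesis using True by simp
  next
    case False
    with \<sigma>0 have \<sigma>pos: "0 < \<sigma>" by simp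
    \<comment> \<open>AM-GM with weight \<open>sqrt \<sigma>\<close> balances the two parts:
      \<open>\<sigma> * q z\<close> has mean \<open>\<sigma> * n\<close>, and the second moment of
      \<open>R\<close>, at most \<sigma> squared, is divided by \<sigma>. This division is why
      \<sigma> = 0 was split off.\<close>
    have pt: "\<bar>R z * h z\<bar> \<le> K * \<mu> * (\<sigma> * q z + (R z)\<^sup>2 / \<sigma>)" for z
    proof -
      have "0 \<le> (sqrt \<sigma> * sqrt (q z) - \<bar>R z\<bar> / sqrt \<sigma>)\<^sup>2" by simp
      also have "\<dots> = \<sigma> * q z + (R z)\<^sup>2 / \<sigma> - 2 * (\<bar>R z\<bar> * sqrt (q z))"
        using \<sigma>pos q0[of z] by (simp add: power2_diff power_mult_distrib power_divide)
      finally have "2 * (\<bar>R z\<bar> * sqrt (q z)) \<le> \<sigma> * q z + (R z)\<^sup>2 / \<sigma>" by simp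
      moreover have "0 \<le> \<bar>R z\<bar> * sqrt (q z)" using q0 by simp
      ultimately have *: "\<bar>R z\<bar> * sqrt (q z) \<le> \<sigma> * q z + (R z)\<^sup>2 / \<sigma>" by linarith
      have "\<bar>R z * h z\<bar> \<le> \<bar>R z\<bar> * (K * \<mu> * sqrt (q z))"
        unfolding abs_mult by (intro mult_left_mono h_bd) auto
      also have "\<dots> = K * \<mu> * (\<bar>R z\<bar> * sqrt (q z))" by simp
      also have "\<dots> \<le> K * \<mu> * (\<sigma> * q z + (R z)\<^sup>2 / \<sigma>)"
        using * K \<mu> by (intro mult_left_mono) auto
      finally show ?thesis .
    qed
    have "\<bar>\<integral>z. R z * h z \<partial>?P\<bar> \<le> (\<integral>z. \<bar>R z * h z\<bar> \<partial>?P)" by (rule integral_abs_bound)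
    also have "\<dots> \<le> (\<integral>z. K * \<mu> * (\<sigma> * q z + (R z)\<^sup>2 / \<sigma>) \<partial>?P)"
      using pt iRh q R2 by (intro integral_mono) auto
    also have "\<dots> = K * \<mu> * (\<sigma> * real n + (exp \<sigma> - 1 - \<sigma>) / \<sigma>)"
      using q R2 by simp
    also have "\<dots> \<le> K * \<mu> * (\<sigma> * real n + \<sigma>)"
    proof -
      have "exp \<sigma> - 1 - \<sigma> \<le> \<sigma> * \<sigma>"
        using exp_bound[OF \<sigma>0 \<sigma>1] by (simp add: power2_eq_square)
      then have "(exp \<sigma> - 1 - \<sigma>) / \<sigma> \<le> \<sigma>" using \<sigma>pos by (simp add: pos_divide_le_eq)
      then show ?thesis using K \<mu> by (intro mult_left_mono) auto
    qed
    finally show ?thesis by (simp add: algebra_simps)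
  qed
  also have "\<dots> = K * (real n + 1) / \<mu> * (\<mu>\<^sup>2 * \<sigma>)"
    using \<mu> by (simp add: power2_eq_square)
  also have "\<dots> \<le> K * (real n + 1) / \<mu> * (\<Sum>i<n. (v i)\<^sup>2)"
    using \<sigma>v K \<mu> by (intro mult_left_mono) auto
  finally show ?thesis unfolding eq .
qed

section \<open>Smoothing with sparse perturbations\<close>

lemma (in pair_sigma_finite) integral_pair_mult:
  fixes f :: "'a \<Rightarrow> real" and g :: "'b \<Rightarrow> real"
  assumes f: "integrable M1 f" and g: "integrable M2 g"
  shows "integrable (M1 \<Otimes>\<^sub>M M2) (\<lambda>p. f (fst p) * g (snd p))"
    and "(\<integral>p. f (fst p) * g (snd p) \<partial>(M1 \<Otimes>\<^sub>M M2)) = (\<integral>x. f x \<partial>M1) * (\<integral>y. g y \<partial>M2)"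
proof -
  have [measurable]: "f \<in> borel_measurable M1" "g \<in> borel_measurable M2" using f g by auto
  show *: "integrable (M1 \<Otimes>\<^sub>M M2) (\<lambda>p. f (fst p) * g (snd p))"
  proof (rule Fubini_integrable)
    show "integrable M1 (\<lambda>x. \<integral>y. norm (f (fst (x, y)) * g (snd (x, y))) \<partial>M2)"
      using f by (simp add: abs_mult)
  qed (use g in auto)
  show "(\<integral>p. f (fst p) * g (snd p) \<partial>(M1 \<Otimes>\<^sub>M M2)) = (\<integral>x. f x \<partial>M1) * (\<integral>y. g y \<partial>M2)"
    using integral_fst'[OF *] by simp
qed

text \<open>The setting of all estimates. The Lipschitz hypothesis is in the seminorm of the active
  coordinates of \<open>x\<close>; \<open>active_lipschitz\<close> derives it from the dependence of
  \<open>F\<close> on the linear scores.\<close>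

locale sparse_smoothing =
  fixes n :: nat and M :: "'x measure" and Y :: "'x \<Rightarrow> 'y set" and \<phi> :: "'x \<Rightarrow> 'y \<Rightarrow> vec"
    and F :: "vec \<Rightarrow> 'x \<Rightarrow> real" and K \<mu> :: real
  assumes prob_M: "prob_space M"
    and active_sets: "\<And>i. i < n \<Longrightarrow> {x \<in> space M. i \<in> active n Y \<phi> x} \<in> sets M"
    and integrable_F: "\<And>w. w \<in> Rn n \<Longrightarrow> integrable M (F w)"
    and K_pos: "0 < K" and \<mu>_pos: "0 < \<mu>"
    and lip_active: "\<And>x w w'. x \<in> space M \<Longrightarrow> w \<in> Rn n \<Longrightarrow> w' \<in> Rn n \<Longrightarrow>
      \<bar>F w x - F w' x\<bar> \<le> K * sqrt (\<Sum>i\<in>active n Y \<phi> x. (w i - w' i)\<^sup>2)"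
begin

abbreviation A :: "'x \<Rightarrow> nat set" where "A \<equiv> active n Y \<phi>"
abbreviation u :: "'x \<times> vec \<Rightarrow> vec" where "u \<equiv> sparse_pert n Y \<phi>"
abbreviation D :: "('x \<times> vec) measure" where "D \<equiv> M \<Otimes>\<^sub>M gauss {..<n}"
abbreviation fs :: "vec \<Rightarrow> real" where "fs \<equiv> smoothed n M Y \<phi> F \<mu>"
abbreviation s :: "vec \<Rightarrow> 'x \<times> vec \<Rightarrow> vec" where "s w p \<equiv> grad_est F \<mu> w (fst p) (u p)"

text \<open>Introduced as the mean of the estimator; \<open>gradient_smoothed\<close> identifies it
  with the gradient of the smoothed function.\<close>

definition grad :: "vec \<Rightarrow> vec" where "grad w i = (\<integral>p. s w p i \<partial>D)"
definition act :: "nat \<Rightarrow> 'x \<Rightarrow> real" where "act i = indicator {x \<in> space M. i \<in> A x}"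
definition \<pi> :: "nat \<Rightarrow> real" where "\<pi> i = (\<integral>x. act i x \<partial>M)"
definition m :: real where "m = (\<Sum>i<n. \<pi> i)"

sublocale P: pair_prob_space M "gauss {..<n}"
  by (intro pair_prob_space.intro pair_sigma_finite.intro prob_space_imp_sigma_finite
      prob_M prob_space_gauss)

lemma draw_eq: "draw n M = D"
  by (simp add: draw_def)

lemma A_subset: "A x \<subseteq> {..<n}"
  by (auto simp: active_def)

lemma finite_A [simp]: "finite (A x)"
  using A_subset finite_subset by blast

lemma u_Rn: "u p \<in> Rn n"
  by (auto simp: sparse_pert_def Rn_def active_def)

lemma act_measurable [measurable]: "i < n \<Longrightarrow> act i \<in> borel_measurable M"
  unfolding act_def by (intro borel_measurable_indicator active_sets)

lemma act_bounds: "0 \<le> act i x" "act i x \<le> 1"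
  by (auto simp: act_def indicator_def)

lemma act_mult_self: "act i x * act i x = act i x"
  by (auto simp: act_def indicator_def)

lemma act_cases: "act i x = 0 \<or> act i x = 1"
  by (auto simp: act_def indicator_def)

lemma integrable_act [simp]: "i < n \<Longrightarrow> integrable M (act i)"
  using act_bounds by (intro P.M1.integrable_const_bound[of _ 1]) auto

lemma \<pi>_bounds: "i < n \<Longrightarrow> 0 \<le> \<pi> i" "i < n \<Longrightarrow> \<pi> i \<le> 1"
  unfolding \<pi>_def using act_bounds
  by (auto intro!: integral_nonneg_AE P.M1.integral_le_const)

lemma m_nonneg: "0 \<le> m"
  unfolding m_def by (intro sum_nonneg \<pi>_bounds) auto

section \<open>Law and moments of the sparse perturbation\<close>

lemma space_D: "p \<in> space D \<Longrightarrow> fst p \<in> space M"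
  by (auto simp: space_pair_measure)

lemma u_eq: "p \<in> space D \<Longrightarrow> u p i = act i (fst p) * snd p i"
  using space_D[of p] by (auto simp: sparse_pert_def act_def)

lemma u_measurable: "(\<lambda>p. u p i) \<in> borel_measurable D"
proof (cases "i < n")
  case True
  have [measurable]: "(\<lambda>p. snd p i) \<in> borel_measurable D" "act i \<in> borel_measurable M"
    using True measurable_component_singleton[of i "{..<n}" "\<lambda>_. stdn"] by auto
  have "(\<lambda>p. act i (fst p) * snd p i) \<in> borel_measurable D" by measurable
  then show ?thesis by (subst measurable_cong[OF u_eq])
next
  case False
  then have "u p i = 0" for p using u_Rn[of p] by (simp add: Rn_def)
  then show ?thesis by simp
qed

text \<open>Activity depends on the input alone and the Gaussian entry on \<open>z\<close> alone, so
  the mean factors. The one-coordinate moments and the fourth-moment bound reduce to this.\<close>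

lemma act_snd_integral:
  fixes h :: "real \<Rightarrow> real"
  assumes i: "i < n" and j: "j < n" and h: "integrable stdn h"
  shows "integrable D (\<lambda>p. act i (fst p) * h (snd p j))"
    and "(\<integral>p. act i (fst p) * h (snd p j) \<partial>D) = \<pi> i * (\<integral>t. h t \<partial>stdn)"
proof -
  have hm: "h \<in> borel_measurable borel" using h by auto
  have h': "integrable (gauss {..<n}) (\<lambda>z. h (z j))"
    "(\<integral>z. h (z j) \<partial>gauss {..<n}) = (\<integral>t. h t \<partial>stdn)"
    using gauss_component[of j "{..<n}" h] j h hm by auto
  show "integrable D (\<lambda>p. act i (fst p) * h (snd p j))"
    using P.integral_pair_mult(1)[OF integrable_act[OF i] h'(1)] by simp
  show "(\<integral>p. act i (fst p) * h (snd p j) \<partial>D) = \<pi> i * (\<integral>t. h t \<partial>stdn)"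
    using P.integral_pair_mult(2)[OF integrable_act[OF i] h'(1)] h'(2) by (simp add: \<pi>_def)
qed

lemma act_fst_integral:
  assumes i: "i < n"
  shows "integrable D (\<lambda>p. act i (fst p))" and "(\<integral>p. act i (fst p) \<partial>D) = \<pi> i"
  using act_snd_integral[OF i i, of "\<lambda>_. 1"] stdn.prob_space by auto

lemma u_square:
  assumes i: "i < n"
  shows "integrable D (\<lambda>p. (u p i)\<^sup>2)" and "(\<integral>p. (u p i)\<^sup>2 \<partial>D) = \<pi> i"
proof -
  have eq: "(u p i)\<^sup>2 = act i (fst p) * (snd p i)\<^sup>2" if "p \<in> space D" for p
    using u_eq[OF that, of i] act_mult_self[of i "fst p"] by (simp add: power2_eq_square mult_ac)
  note * = act_snd_integral[OF i i integrable_stdn_power[of 2]]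
  show "integrable D (\<lambda>p. (u p i)\<^sup>2)" by (subst Bochner_Integration.integrable_cong[OF refl eq]) (use * in auto)
  show "(\<integral>p. (u p i)\<^sup>2 \<partial>D) = \<pi> i"
    by (subst Bochner_Integration.integral_cong[OF refl eq]) (use * integral_stdn_2 in auto)
qed

lemma u_norm_square:
  "integrable D (\<lambda>p. (vnorm n (u p))\<^sup>2)" "(\<integral>p. (vnorm n (u p))\<^sup>2 \<partial>D) = m"
  unfolding vnorm_sq m_def
  by (auto intro!: Bochner_Integration.integrable_sum simp: Bochner_Integration.integral_sum u_square)

lemma u_abs:
  assumes i: "i < n"
  shows "integrable D (\<lambda>p. \<bar>u p i\<bar>)" and "(\<integral>p. \<bar>u p i\<bar> \<partial>D) \<le> \<pi> i"
proof -
  note [measurable] = u_measurable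
  have pt: "\<bar>u p i\<bar> \<le> (act i (fst p) + (u p i)\<^sup>2) / 2" if "p \<in> space D" for p
  proof -
    \<comment> \<open>With \<open>act i\<close> in place of 1 this integrates to
      \<open>(\<pi> i + \<pi> i) / 2\<close>, hence to the bound \<open>\<pi> i\<close> with
      constant 1.\<close>
    have "\<bar>t\<bar> \<le> (1 + t\<^sup>2) / 2" for t :: real
      using abs_mult_le_squares[of t 1] by simp
    then show ?thesis using u_eq[OF that, of i] act_cases[of i "fst p"] by auto
  qed
  have int: "integrable D (\<lambda>p. (act i (fst p) + (u p i)\<^sup>2) / 2)"
    using act_fst_integral[OF i] u_square[OF i] by simp
  show *: "integrable D (\<lambda>p. \<bar>u p i\<bar>)"
    by (rule Bochner_Integration.integrable_bound[OF int])
      (measurable, intro AE_I2, use pt in fastforce)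
  have "(\<integral>p. \<bar>u p i\<bar> \<partial>D) \<le> (\<integral>p. (act i (fst p) + (u p i)\<^sup>2) / 2 \<partial>D)"
    by (rule integral_mono[OF * int pt])
  then show "(\<integral>p. \<bar>u p i\<bar> \<partial>D) \<le> \<pi> i"
    using act_fst_integral[OF i] u_square[OF i] by simp
qed

text \<open>Dropping the factor \<open>act i\<close>, at most 1, leaves no joint activation
  probability: summed over \<open>j\<close>, the bound gives \<open>3 * m\<close> and not a second
  moment of the number of active coordinates. AM-GM reduces the mixed moment to the fourth moment 3
  of a normal variable.\<close>

lemma u_fourth:
  assumes i: "i < n" and j: "j < n"
  shows "integrable D (\<lambda>p. (u p i)\<^sup>2 * (u p j)\<^sup>2)" and "(\<integral>p. (u p i)\<^sup>2 * (u p j)\<^sup>2 \<partial>D) \<le> 3 * \<pi> j"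
proof -
  note [measurable] = u_measurable
  let ?B = "\<lambda>p. (act j (fst p) * (snd p i) ^ 4 + act j (fst p) * (snd p j) ^ 4) / 2"
  note a = act_snd_integral[OF j i integrable_stdn_power[of 4]]
    act_snd_integral[OF j j integrable_stdn_power[of 4]]
  have pt: "(u p i)\<^sup>2 * (u p j)\<^sup>2 \<le> ?B p" if "p \<in> space D" for p
  proof -
    let ?x = "snd p i" and ?y = "snd p j"
    have "(u p i)\<^sup>2 * (u p j)\<^sup>2 = act i (fst p) * (act j (fst p) * (?x\<^sup>2 * ?y\<^sup>2))"
      using u_eq[OF that] act_cases[of i "fst p"] act_cases[of j "fst p"] by auto
    also have "\<dots> \<le> 1 * (act j (fst p) * (?x\<^sup>2 * ?y\<^sup>2))"
      using act_bounds by (intro mult_right_mono) auto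
    also have "\<dots> \<le> act j (fst p) * ((?x ^ 4 + ?y ^ 4) / 2)"
    proof -
      have "?x\<^sup>2 * ?y\<^sup>2 \<le> (?x ^ 4 + ?y ^ 4) / 2"
        using zero_le_power2[of "?x\<^sup>2 - ?y\<^sup>2"] by (simp add: power2_diff)
      then show ?thesis unfolding mult_1_left by (rule mult_left_mono[OF _ act_bounds(1)])
    qed
    finally show ?thesis by (simp add: algebra_simps)
  qed
  have int: "integrable D ?B" using a by simp
  show *: "integrable D (\<lambda>p. (u p i)\<^sup>2 * (u p j)\<^sup>2)"
    by (rule Bochner_Integration.integrable_bound[OF int])
      (measurable, intro AE_I2, use pt in fastforce)
  have "(\<integral>p. (u p i)\<^sup>2 * (u p j)\<^sup>2 \<partial>D) \<le> (\<integral>p. ?B p \<partial>D)"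
    by (rule integral_mono[OF * int pt])
  then show "(\<integral>p. (u p i)\<^sup>2 * (u p j)\<^sup>2 \<partial>D) \<le> 3 * \<pi> j"
    using a integral_stdn_4 by simp
qed

definition q :: "vec \<Rightarrow> real" where "q v = (\<Sum>i<n. \<pi> i * (v i)\<^sup>2)"

text \<open>Activations of different coordinates may be correlated, but they are multiplied by the
  covariance of independent Gaussian entries, which vanishes off the diagonal.\<close>

lemma u_linear_square:
  shows "integrable D (\<lambda>p. (\<Sum>i<n. v i * u p i)\<^sup>2)"
    and "(\<integral>p. (\<Sum>i<n. v i * u p i)\<^sup>2 \<partial>D) = q v"
proof -
  let ?T = "\<lambda>i j p. v i * v j * (act i (fst p) * act j (fst p) * (snd p i * snd p j))"
  have eq: "(\<Sum>i<n. v i * u p i)\<^sup>2 = (\<Sum>i<n. \<Sum>j<n. ?T i j p)" if "p \<in> space D" for p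
    by (simp add: power2_eq_square sum_product mult_ac u_eq[OF that])
  have int: "integrable D (?T i j)" and
    val: "(\<integral>p. ?T i j p \<partial>D) = (if i = j then \<pi> i * (v i)\<^sup>2 else 0)" if "i < n" "j < n" for i j
  proof -
    have a: "integrable M (\<lambda>x. act i x * act j x)"
    proof (rule P.M1.integrable_const_bound[of _ 1])
      show "AE x in M. norm (act i x * act j x) \<le> 1"
        using act_bounds by (auto simp: abs_mult intro!: mult_le_one)
    qed (use that in measurable)
    note c = gauss_covariance[of "{..<n}" i j, simplified, OF that]
    show "integrable D (?T i j)"
      by (intro integrable_mult_right P.integral_pair_mult(1)[OF a c(1)])
    have "(\<integral>p. ?T i j p \<partial>D) = v i * v j * ((\<integral>x. act i x * act j x \<partial>M) * (if i = j then 1 else 0))"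
      using P.integral_pair_mult(2)[OF a c(1)] c(2) by simp
    also have "\<dots> = (if i = j then \<pi> i * (v i)\<^sup>2 else 0)"
      by (simp add: \<pi>_def act_mult_self power2_eq_square)
    finally show "(\<integral>p. ?T i j p \<partial>D) = (if i = j then \<pi> i * (v i)\<^sup>2 else 0)" .
  qed
  have int': "integrable D (\<lambda>p. \<Sum>j<n. ?T i j p)" if "i < n" for i
    by (rule Bochner_Integration.integrable_sum, rule int) (use that in auto)
  have "integrable D (\<lambda>p. \<Sum>i<n. \<Sum>j<n. ?T i j p)"
    by (rule Bochner_Integration.integrable_sum, rule int') auto
  then show "integrable D (\<lambda>p. (\<Sum>i<n. v i * u p i)\<^sup>2)"
    by (subst Bochner_Integration.integrable_cong[OF refl eq]) auto
  have "(\<integral>p. (\<Sum>i<n. v i * u p i)\<^sup>2 \<partial>D) = (\<integral>p. (\<Sum>i<n. \<Sum>j<n. ?T i j p) \<partial>D)"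
    by (rule Bochner_Integration.integral_cong[OF refl eq])
  also have "\<dots> = (\<Sum>i<n. \<integral>p. (\<Sum>j<n. ?T i j p) \<partial>D)"
    by (rule Bochner_Integration.integral_sum, rule int') auto
  also have "\<dots> = (\<Sum>i<n. \<Sum>j<n. \<integral>p. ?T i j p \<partial>D)"
    by (intro sum.cong refl Bochner_Integration.integral_sum int) auto
  also have "\<dots> = (\<Sum>i<n. \<Sum>j<n. if i = j then \<pi> i * (v i)\<^sup>2 else 0)"
    by (intro sum.cong refl val) auto
  also have "\<dots> = q v"
    by (simp add: q_def)
  finally show "(\<integral>p. (\<Sum>i<n. v i * u p i)\<^sup>2 \<partial>D) = q v" .
qed

lemma active_norm_square:
  shows "integrable D (\<lambda>p. \<Sum>i\<in>A (fst p). (v i)\<^sup>2)" and "(\<integral>p. (\<Sum>i\<in>A (fst p). (v i)\<^sup>2) \<partial>D) = q v"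
proof -
  have eq: "(\<Sum>i\<in>A (fst p). (v i)\<^sup>2) = (\<Sum>i<n. act i (fst p) * (v i)\<^sup>2)" if "p \<in> space D" for p
    using A_subset space_D[OF that]
    by (intro sum.mono_neutral_cong_left) (auto simp: act_def)
  show "integrable D (\<lambda>p. \<Sum>i\<in>A (fst p). (v i)\<^sup>2)"
    by (subst Bochner_Integration.integrable_cong[OF refl eq])
      (auto intro!: Bochner_Integration.integrable_sum simp: act_fst_integral)
  have "(\<integral>p. (\<Sum>i\<in>A (fst p). (v i)\<^sup>2) \<partial>D) = (\<integral>p. (\<Sum>i<n. act i (fst p) * (v i)\<^sup>2) \<partial>D)"
    by (rule Bochner_Integration.integral_cong[OF refl eq])
  also have "\<dots> = q v"
    by (simp add: Bochner_Integration.integral_sum act_fst_integral q_def)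
  finally show "(\<integral>p. (\<Sum>i\<in>A (fst p). (v i)\<^sup>2) \<partial>D) = q v" .
qed

text \<open>Links the hypothesis on the expected number of nonzero entries to \<open>m\<close>: an
  active coordinate has a Gaussian entry, which is zero with probability 0.\<close>

lemma l0norm_integral: "(\<integral>p. real (l0norm n (u p)) \<partial>D) = m"
proof -
  let ?h = "\<lambda>t :: real. indicator (- {0}) t :: real"
  have h: "integrable stdn ?h" "(\<integral>t. ?h t \<partial>stdn) = 1"
  proof -
    show i: "integrable stdn ?h"
      by (rule stdn.integrable_const_bound[of _ 1]) (auto simp: indicator_def)
    have "AE t in stdn. t \<noteq> 0"
      using AE_lborel_singleton[of "0 :: real"] by (subst AE_density) auto
    then have "(\<integral>t. ?h t \<partial>stdn) = (\<integral>t. 1 \<partial>stdn)"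
      by (intro integral_cong_AE) auto
    then show "(\<integral>t. ?h t \<partial>stdn) = 1" using stdn.prob_space by simp
  qed
  have eq: "real (l0norm n (u p)) = (\<Sum>i<n. act i (fst p) * ?h (snd p i))" if "p \<in> space D" for p
  proof -
    have "real (l0norm n (u p)) = (\<Sum>i\<in>{i. i < n \<and> u p i \<noteq> 0}. 1)" by (simp add: l0norm_def)
    also have "\<dots> = (\<Sum>i<n. act i (fst p) * ?h (snd p i))"
      using space_D[OF that] by (intro sum.mono_neutral_cong_left) (auto simp: sparse_pert_def act_def indicator_def split: if_splits)
    finally show ?thesis .
  qed
  have "(\<integral>p. real (l0norm n (u p)) \<partial>D) = (\<integral>p. (\<Sum>i<n. act i (fst p) * ?h (snd p i)) \<partial>D)"
    by (rule Bochner_Integration.integral_cong[OF refl eq])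
  also have "\<dots> = (\<Sum>i<n. \<integral>p. act i (fst p) * ?h (snd p i) \<partial>D)"
    by (rule Bochner_Integration.integral_sum) (use act_snd_integral h in auto)
  also have "\<dots> = m"
    unfolding m_def using act_snd_integral(2) h by (intro sum.cong) auto
  finally show ?thesis .
qed

section \<open>Lipschitz bounds, integrability and the bias of smoothing\<close>

lemma active_norm_le: "sqrt (\<Sum>i\<in>A x. (v i)\<^sup>2) \<le> vnorm n v"
  unfolding vnorm_def L2_set_def using A_subset by (intro real_sqrt_le_mono sum_mono2) auto

lemma F_lipschitz: "x \<in> space M \<Longrightarrow> lipschitz_Rn n K (\<lambda>w. F w x)"
  unfolding lipschitz_Rn_def
  by (intro ballI order_trans[OF lip_active] mult_left_mono active_norm_le) (use K_pos in auto)

lemma Rn_pert: "w \<in> Rn n \<Longrightarrow> (\<lambda>i. w i + c * u p i) \<in> Rn n"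
  using u_Rn[of p] by (simp add: Rn_def)

lemma F_measurable_comp:
  assumes "\<And>i. i < n \<Longrightarrow> (\<lambda>z. W z i) \<in> borel_measurable P" "\<And>z. z \<in> space P \<Longrightarrow> W z \<in> Rn n"
    and X: "X \<in> measurable P M"
  shows "(\<lambda>z. F (W z) (X z)) \<in> borel_measurable P"
proof (rule borel_measurable_lipschitz_comp[of n "\<lambda>w z. F w (X z)" P K W])
  fix w assume "w \<in> Rn n"
  then have "F w \<in> borel_measurable M" using integrable_F by auto
  then show "(\<lambda>z. F w (X z)) \<in> borel_measurable P" using X by (rule measurable_compose[rotated])
next
  fix z assume "z \<in> space P"
  then show "lipschitz_Rn n K (\<lambda>w. F w (X z))"
    using F_lipschitz measurable_space[OF X] by auto
qed (use assms in auto)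

lemma F_pert_bound:
  assumes "p \<in> space D" "w \<in> Rn n"
  shows "\<bar>F (\<lambda>i. w i + \<mu> * u p i) (fst p) - F w (fst p)\<bar> \<le> K * \<mu> * vnorm n (u p)"
proof -
  have "\<bar>F (\<lambda>i. w i + \<mu> * u p i) (fst p) - F w (fst p)\<bar>
      \<le> K * vnorm n (\<lambda>i. w i + \<mu> * u p i - w i)"
    using F_lipschitz[OF space_D[OF assms(1)]] Rn_pert[OF assms(2)] assms(2)
    unfolding lipschitz_Rn_def by blast
  also have "(\<lambda>i. w i + \<mu> * u p i - w i) = (\<lambda>i. \<mu> * u p i)" by auto
  finally show ?thesis using \<mu>_pos by (simp add: vnorm_scale)
qed

lemma F_pert_measurable:
  assumes "w \<in> Rn n"
  shows "(\<lambda>p. F (\<lambda>i. w i + \<mu> * u p i) (fst p)) \<in> borel_measurable D"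
  using u_measurable by (intro F_measurable_comp Rn_pert assms) auto

lemma vnorm_u_measurable: "(\<lambda>p. vnorm n (u p)) \<in> borel_measurable D"
  unfolding vnorm_def L2_set_def using u_measurable by measurable

lemma integrable_F_fst:
  assumes "w \<in> Rn n"
  shows "integrable D (\<lambda>p. F w (fst p))" and "(\<integral>p. F w (fst p) \<partial>D) = objective M F w"
  using P.integral_pair_mult[of "F w" "\<lambda>_. 1"] integrable_F[OF assms]
    measure_space_gauss[of "{..<n}"]
  by (auto simp: objective_def)

text \<open>Serves to bound the mean Euclidean norm of the perturbation by \<open>m\<close>, which
  makes the bias of smoothing at most \<open>K * \<mu> * m\<close>. This factor is one of the three
  powers of \<open>nbar\<close> in the final rate.\<close>

lemma vnorm_u_sum:
  shows "integrable D (\<lambda>p. \<Sum>i<n. \<bar>u p i\<bar>)" and "(\<integral>p. (\<Sum>i<n. \<bar>u p i\<bar>) \<partial>D) \<le> m"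
proof -
  show "integrable D (\<lambda>p. \<Sum>i<n. \<bar>u p i\<bar>)"
    by (rule Bochner_Integration.integrable_sum) (simp add: u_abs)
  have "(\<integral>p. (\<Sum>i<n. \<bar>u p i\<bar>) \<partial>D) = (\<Sum>i<n. \<integral>p. \<bar>u p i\<bar> \<partial>D)"
    by (rule Bochner_Integration.integral_sum) (simp add: u_abs)
  also have "\<dots> \<le> m" unfolding m_def by (intro sum_mono u_abs) auto
  finally show "(\<integral>p. (\<Sum>i<n. \<bar>u p i\<bar>) \<partial>D) \<le> m" .
qed

lemma integrable_vnorm_u: "integrable D (\<lambda>p. vnorm n (u p))"
proof (rule Bochner_Integration.integrable_bound[OF vnorm_u_sum(1) vnorm_u_measurable])
  show "AE p in D. norm (vnorm n (u p)) \<le> norm (\<Sum>i<n. \<bar>u p i\<bar>)"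
    using vnorm_le_sum_abs[of n] by (auto intro!: AE_I2 simp: sum_nonneg)
qed

lemma vnorm_u_integral: "(\<integral>p. vnorm n (u p) \<partial>D) \<le> m"
  by (rule order_trans[OF integral_mono[OF integrable_vnorm_u vnorm_u_sum(1) vnorm_le_sum_abs] vnorm_u_sum(2)])

lemma integrable_F_pert_diff:
  assumes w: "w \<in> Rn n"
  shows "integrable D (\<lambda>p. F (\<lambda>i. w i + \<mu> * u p i) (fst p) - F w (fst p))"
proof (rule Bochner_Integration.integrable_bound[OF integrable_mult_right[OF integrable_vnorm_u]])
  show "AE p in D. norm (F (\<lambda>i. w i + \<mu> * u p i) (fst p) - F w (fst p)) \<le> norm (K * \<mu> * vnorm n (u p))"
    using K_pos \<mu>_pos F_pert_bound[OF _ w] by (intro AE_I2) simp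
qed (use F_pert_measurable[OF w] integrable_F_fst[OF w] in simp)

lemma integrable_F_pert:
  assumes w: "w \<in> Rn n"
  shows "integrable D (\<lambda>p. F (\<lambda>i. w i + \<mu> * u p i) (fst p))"
  using Bochner_Integration.integrable_add[OF integrable_F_pert_diff[OF w] integrable_F_fst(1)[OF w]]
  by simp

lemma smoothed_eq: "fs w = (\<integral>p. F (\<lambda>i. w i + \<mu> * u p i) (fst p) \<partial>D)"
  by (simp add: smoothed_def draw_eq)

lemma smoothed_le:
  assumes w: "w \<in> Rn n"
  shows "fs w \<le> objective M F w + K * \<mu> * m"
proof -
  have "fs w - objective M F w = (\<integral>p. F (\<lambda>i. w i + \<mu> * u p i) (fst p) - F w (fst p) \<partial>D)"
    using integrable_F_pert[OF w] integrable_F_fst[OF w] by (simp add: smoothed_eq)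
  also have "\<dots> \<le> (\<integral>p. K * \<mu> * vnorm n (u p) \<partial>D)"
    using F_pert_bound[OF _ w] integrable_F_pert_diff[OF w] integrable_vnorm_u
    by (intro integral_mono) (auto simp: abs_le_iff)
  also have "\<dots> \<le> K * \<mu> * m"
    using vnorm_u_integral K_pos \<mu>_pos by simp
  finally show ?thesis by simp
qed

section \<open>The gradient estimator and the gradient of the smoothed function\<close>

lemma grad_est_bound:
  assumes "p \<in> space D" "w \<in> Rn n"
  shows "\<bar>s w p i\<bar> \<le> K * vnorm n (u p) * \<bar>u p i\<bar>"
proof -
  have "\<bar>(F (\<lambda>j. w j + \<mu> * u p j) (fst p) - F w (fst p)) / \<mu>\<bar> \<le> K * vnorm n (u p)"
    using F_pert_bound[OF assms] \<mu>_pos by (simp add: abs_divide pos_divide_le_eq mult_ac)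
  then show ?thesis
    unfolding grad_est_def abs_mult by (intro mult_right_mono) auto
qed

lemma grad_est_measurable:
  assumes w: "w \<in> Rn n"
  shows "(\<lambda>p. s w p i) \<in> borel_measurable D"
proof -
  note [measurable] = F_pert_measurable[OF w] u_measurable
    borel_measurable_integrable[OF integrable_F_fst(1)[OF w]]
  show ?thesis unfolding grad_est_def by measurable
qed

lemma grad_est_Rn: "s w p \<in> Rn n"
  using u_Rn[of p] by (simp add: grad_est_def Rn_def)

lemma grad_Rn: "grad w \<in> Rn n"
  using grad_est_Rn by (simp add: grad_def Rn_def)

lemma integrable_grad_est:
  assumes w: "w \<in> Rn n"
  shows "integrable D (\<lambda>p. s w p i)"
proof (cases "i < n")
  case True
  show ?thesis
  proof (rule Bochner_Integration.integrable_bound[OF integrable_mult_right[OF u_norm_square(1)]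
        grad_est_measurable[OF w]])
    show "AE p in D. norm (s w p i) \<le> norm (K * (vnorm n (u p))\<^sup>2)"
    proof (intro AE_I2)
      fix p assume p: "p \<in> space D"
      have "\<bar>s w p i\<bar> \<le> K * vnorm n (u p) * \<bar>u p i\<bar>" by (rule grad_est_bound[OF p w])
      also have "\<dots> \<le> K * vnorm n (u p) * vnorm n (u p)"
        using K_pos by (intro mult_left_mono abs_le_vnorm True) auto
      finally show "norm (s w p i) \<le> norm (K * (vnorm n (u p))\<^sup>2)"
        using K_pos by (simp add: power2_eq_square mult_ac)
    qed
  qed
next
  case False
  then show ?thesis using grad_est_Rn[of w] by (simp add: Rn_def)
qed

lemma grad_inner: "w \<in> Rn n \<Longrightarrow> vinner n (grad w) v = (\<integral>p. (\<Sum>i<n. v i * s w p i) \<partial>D)"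
  unfolding vinner_def grad_def
  by (simp add: Bochner_Integration.integral_sum integrable_grad_est mult.commute)

text \<open>The Gaussian expansion is applied for each fixed input \<open>x\<close> with the active
  set \<open>A x\<close>, and its bound, uniform in \<open>x\<close>, is integrated over the inputs.
  The dimension in the constant is harmless, as the expansion serves only to establish
  differentiability.\<close>

lemma smoothed_expansion:
  assumes w: "w \<in> Rn n" and v: "v \<in> Rn n" and small: "vnorm n v \<le> \<mu>"
  shows "\<bar>fs (\<lambda>i. w i + v i) - fs w - vinner n (grad w) v\<bar> \<le> K * (real n + 1) / \<mu> * (vnorm n v)\<^sup>2"
proof -
  have wv: "(\<lambda>i. w i + v i) \<in> Rn n" using Rn_add[OF w v, of 1] by simp
  define \<Phi> where "\<Phi> p = F (\<lambda>i. w i + v i + \<mu> * u p i) (fst p) - F (\<lambda>i. w i + \<mu> * u p i) (fst p)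
      - (\<Sum>i<n. v i * s w p i)" for p
  have i3: "integrable D (\<lambda>p. \<Sum>i<n. v i * s w p i)"
    by (intro Bochner_Integration.integrable_sum integrable_mult_right integrable_grad_est w)
  have int: "integrable D \<Phi>"
    unfolding \<Phi>_def using integrable_F_pert[OF wv] integrable_F_pert[OF w] i3 by simp
  define c where "c = K * (real n + 1) / \<mu> * (vnorm n v)\<^sup>2"
  have small': "(\<Sum>i<n. (v i)\<^sup>2) \<le> \<mu>\<^sup>2"
    using power_mono[OF small, of 2] by (simp add: vnorm_sq)
  have inner: "\<bar>\<integral>z. \<Phi> (x, z) \<partial>gauss {..<n}\<bar> \<le> c" if x: "x \<in> space M" for x
    using gauss_smoothing_expansion[of "A x" n K \<mu> "\<lambda>w. F w x" w v, OF A_subset _ \<mu>_pos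
        lip_active[OF x] w v small'] K_pos
    by (simp add: \<Phi>_def c_def vnorm_sq grad_est_def sparse_pert_def cong: if_cong)
  have "fs (\<lambda>i. w i + v i) - fs w - vinner n (grad w) v = (\<integral>p. \<Phi> p \<partial>D)"
    unfolding \<Phi>_def using integrable_F_pert[OF wv] integrable_F_pert[OF w] i3
    by (simp add: smoothed_eq grad_inner[OF w])
  also have "\<dots> = (\<integral>x. \<integral>z. \<Phi> (x, z) \<partial>gauss {..<n} \<partial>M)"
    by (rule P.integral_fst'[OF int, symmetric])
  finally have eq: "fs (\<lambda>i. w i + v i) - fs w - vinner n (grad w) v
      = (\<integral>x. \<integral>z. \<Phi> (x, z) \<partial>gauss {..<n} \<partial>M)" .
  have int': "integrable M (\<lambda>x. \<integral>z. \<Phi> (x, z) \<partial>gauss {..<n})"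
    by (rule P.integrable_fst'[OF int])
  have "(\<integral>x. \<integral>z. \<Phi> (x, z) \<partial>gauss {..<n} \<partial>M) \<le> c"
    by (rule P.M1.integral_le_const[OF int']) (use inner in \<open>auto simp: abs_le_iff intro!: AE_I2\<close>)
  moreover have "(\<integral>x. \<integral>z. \<Phi> (x, z) \<partial>gauss {..<n} \<partial>M) \<ge> - c"
    by (rule P.M1.integral_ge_const[OF int']) (use inner in \<open>force simp: abs_le_iff intro!: AE_I2\<close>)
  ultimately show ?thesis unfolding eq c_def by (simp add: abs_le_iff)
qed

lemma has_gradient_smoothed:
  assumes w: "w \<in> Rn n"
  shows "has_gradient n fs (grad w) w"
  unfolding has_gradient_def
proof (intro conjI allI impI)
  show "grad w \<in> Rn n" by (rule grad_Rn)
  fix e :: real assume e: "0 < e"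
  define C where "C = K * (real n + 1) / \<mu> + 1"
  have "0 \<le> K * (real n + 1) / \<mu>" using K_pos \<mu>_pos by simp
  then have C: "C > 0" "K * (real n + 1) / \<mu> \<le> C" by (auto simp: C_def)
  show "\<exists>d>0. \<forall>v\<in>Rn n. vnorm n (\<lambda>i. v i - w i) < d \<longrightarrow>
      \<bar>fs v - fs w - vinner n (grad w) (\<lambda>i. v i - w i)\<bar> \<le> e * vnorm n (\<lambda>i. v i - w i)"
  proof (intro exI[of _ "min \<mu> (e / C)"] conjI ballI impI)
    show "0 < min \<mu> (e / C)" using \<mu>_pos e C by simp
    fix v assume v: "v \<in> Rn n" and d: "vnorm n (\<lambda>i. v i - w i) < min \<mu> (e / C)"
    let ?d = "\<lambda>i. v i - w i"
    have R: "?d \<in> Rn n" using v w by (simp add: Rn_def)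
    have "\<bar>fs v - fs w - vinner n (grad w) ?d\<bar> \<le> K * (real n + 1) / \<mu> * (vnorm n ?d)\<^sup>2"
      using smoothed_expansion[OF w R] d by simp
    also have "\<dots> \<le> C * (vnorm n ?d)\<^sup>2" using C by (intro mult_right_mono) auto
    also have "\<dots> = (C * vnorm n ?d) * vnorm n ?d" by (simp add: power2_eq_square)
    also have "\<dots> \<le> e * vnorm n ?d"
      using d C by (intro mult_right_mono) (auto simp: pos_less_divide_eq mult.commute)
    finally show "\<bar>fs v - fs w - vinner n (grad w) ?d\<bar> \<le> e * vnorm n ?d" .
  qed
qed

lemma gradient_smoothed: "w \<in> Rn n \<Longrightarrow> gradient n fs w = grad w"
  by (rule gradient_eqI[OF has_gradient_smoothed])

subsection \<open>Curvature and descent\<close>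

text \<open>Regroups the difference so that each bracket compares \<open>w\<close> with
  \<open>w'\<close> under the same perturbation; Lipschitz continuity then bounds it by the distance
  from \<open>w\<close> to \<open>w'\<close> instead of by the size of the perturbation.\<close>

lemma grad_est_diff:
  "s w p i - s w' p i = (F (\<lambda>i. w i + \<mu> * u p i) (fst p) - F (\<lambda>i. w' i + \<mu> * u p i) (fst p)
    - (F w (fst p) - F w' (fst p))) / \<mu> * u p i"
  unfolding grad_est_def by (simp add: diff_divide_distrib add_divide_distrib algebra_simps)

text \<open>The scalar difference quotient is at most \<open>2 * K * sqrt (?N p) / \<mu>\<close>,
  with \<open>?N p\<close> the squared active seminorm of \<open>v\<close>, and it multiplies the
  linear form \<open>?L p\<close> in the perturbation. AM-GM separates the two factors, and each of
  \<open>?N p\<close> and the square of \<open>?L p\<close> has mean \<open>q v\<close>.\<close>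

lemma grad_curvature:
  assumes w: "w \<in> Rn n" and v: "v \<in> Rn n" and t: "0 \<le> t" "t \<le> 1"
  shows "vinner n (grad (\<lambda>i. w i + t * v i)) v - vinner n (grad w) v \<le> 2 * K / \<mu> * q v"
proof -
  let ?w = "\<lambda>i. w i + t * v i"
  let ?N = "\<lambda>p. \<Sum>i\<in>A (fst p). (v i)\<^sup>2"
  let ?L = "\<lambda>p. (\<Sum>i<n. v i * u p i)"
  have w': "?w \<in> Rn n" by (rule Rn_add[OF w v])
  have i: "integrable D (\<lambda>p. \<Sum>i<n. v i * s w p i)" if "w \<in> Rn n" for w
    by (intro Bochner_Integration.integrable_sum integrable_mult_right integrable_grad_est that)
  have pt: "(\<Sum>i<n. v i * s ?w p i) - (\<Sum>i<n. v i * s w p i) \<le> K / \<mu> * (?N p + (?L p)\<^sup>2)"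
    if p: "p \<in> space D" for p
  proof -
    let ?x = "fst p"
    let ?d = "F (\<lambda>i. ?w i + \<mu> * u p i) ?x - F (\<lambda>i. w i + \<mu> * u p i) ?x - (F ?w ?x - F w ?x)"
    have x: "?x \<in> space M" by (rule space_D[OF p])
    have "(\<Sum>i<n. v i * s ?w p i) - (\<Sum>i<n. v i * s w p i) = (\<Sum>i<n. v i * (s ?w p i - s w p i))"
      by (simp add: sum_subtractf right_diff_distrib)
    also have "\<dots> = ?d / \<mu> * ?L p"
      unfolding grad_est_diff sum_distrib_left
    proof (rule sum.cong[OF refl])
      fix i
      show "v i * (?d / \<mu> * u p i) = ?d / \<mu> * (v i * u p i)" by (rule mult.left_commute)
    qed
    also have "\<dots> \<le> \<bar>?d\<bar> / \<mu> * \<bar>?L p\<bar>"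
    proof -
      have "\<bar>?d / \<mu> * ?L p\<bar> = \<bar>?d\<bar> / \<mu> * \<bar>?L p\<bar>"
        by (simp only: abs_mult abs_divide abs_of_pos[OF \<mu>_pos])
      then show ?thesis by (rule ord_le_eq_trans[OF abs_ge_self])
    qed
    also have "\<dots> \<le> (2 * K * sqrt (?N p)) / \<mu> * \<bar>?L p\<bar>"
    proof -
      have tN: "sqrt (\<Sum>i\<in>A ?x. (t * v i)\<^sup>2) \<le> sqrt (?N p)"
      proof (intro real_sqrt_le_mono sum_mono)
        fix i
        have "t\<^sup>2 * (v i)\<^sup>2 \<le> 1 * (v i)\<^sup>2" using t by (intro mult_right_mono) (auto simp: power_le_one)
        then show "(t * v i)\<^sup>2 \<le> (v i)\<^sup>2" by (simp add: power_mult_distrib)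
      qed
      have "\<bar>F (\<lambda>i. ?w i + \<mu> * u p i) ?x - F (\<lambda>i. w i + \<mu> * u p i) ?x\<bar> \<le> K * sqrt (?N p)"
        using lip_active[OF x Rn_pert[OF w'] Rn_pert[OF w], of \<mu> p \<mu> p] tN K_pos
        by (auto intro: order_trans)
      moreover have "\<bar>F ?w ?x - F w ?x\<bar> \<le> K * sqrt (?N p)"
        using lip_active[OF x w' w] tN K_pos by (auto intro: order_trans)
      ultimately have "\<bar>?d\<bar> \<le> 2 * K * sqrt (?N p)" by linarith
      then show ?thesis using \<mu>_pos by (intro mult_right_mono divide_right_mono) auto
    qed
    also have "\<dots> = K / \<mu> * (2 * (sqrt (?N p) * \<bar>?L p\<bar>))" by simp
    also have "\<dots> \<le> K / \<mu> * (?N p + (?L p)\<^sup>2)"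
    proof -
      have "0 \<le> ?N p" by (simp add: sum_nonneg)
      then have "2 * (sqrt (?N p) * \<bar>?L p\<bar>) \<le> ?N p + (?L p)\<^sup>2"
        using abs_mult_le_squares[of "sqrt (?N p)" "\<bar>?L p\<bar>"] by (simp add: abs_mult)
      then show ?thesis using K_pos \<mu>_pos by (intro mult_left_mono) auto
    qed
    finally show ?thesis .
  qed
  have "vinner n (grad ?w) v - vinner n (grad w) v
      = (\<integral>p. (\<Sum>i<n. v i * s ?w p i) - (\<Sum>i<n. v i * s w p i) \<partial>D)"
    using i[OF w] i[OF w'] by (simp add: grad_inner[OF w] grad_inner[OF w'])
  also have "\<dots> \<le> (\<integral>p. K / \<mu> * (?N p + (?L p)\<^sup>2) \<partial>D)"
    using i[OF w] i[OF w'] active_norm_square(1) u_linear_square(1) pt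
    by (intro integral_mono) auto
  also have "\<dots> = 2 * K / \<mu> * q v"
    using active_norm_square[of v] u_linear_square[of v] by simp
  finally show ?thesis .
qed

text \<open>The mean value theorem gives the slope at an intermediate point of the segment, and
  \<open>grad_curvature\<close> compares it with the slope at \<open>w\<close>.\<close>

lemma smoothed_descent:
  assumes w: "w \<in> Rn n" and v: "v \<in> Rn n"
  shows "fs (\<lambda>i. w i + v i) \<le> fs w + vinner n (grad w) v + 2 * K / \<mu> * q v"
proof -
  have "\<exists>t>0. t < 1 \<and> fs (\<lambda>i. w i + 1 * v i) - fs (\<lambda>i. w i + 0 * v i)
      = (1 - 0) * vinner n (grad (\<lambda>i. w i + t * v i)) v"
    by (rule MVT2) (auto intro!: has_gradient_line[OF has_gradient_smoothed] Rn_add w v)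
  then obtain t where t: "0 < t" "t < 1"
    "fs (\<lambda>i. w i + v i) - fs w = vinner n (grad (\<lambda>i. w i + t * v i)) v" by auto
  then show ?thesis using grad_curvature[OF w v, of t] by linarith
qed

section \<open>Crude Lipschitz and size bounds for the smoothed function and its gradient\<close>

lemma smoothed_lipschitz: "lipschitz_Rn n K fs"
  unfolding lipschitz_Rn_def
proof (intro ballI)
  fix w w' assume w: "w \<in> Rn n" and w': "w' \<in> Rn n"
  have pt: "\<bar>F (\<lambda>i. w i + \<mu> * u p i) (fst p) - F (\<lambda>i. w' i + \<mu> * u p i) (fst p)\<bar>
      \<le> K * vnorm n (\<lambda>i. w i - w' i)" if "p \<in> space D" for p
    using F_lipschitz[OF space_D[OF that]] Rn_pert[OF w, of \<mu> p] Rn_pert[OF w', of \<mu> p]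
    unfolding lipschitz_Rn_def by fastforce
  have "fs w - fs w' = (\<integral>p. F (\<lambda>i. w i + \<mu> * u p i) (fst p) - F (\<lambda>i. w' i + \<mu> * u p i) (fst p) \<partial>D)"
    using integrable_F_pert[OF w] integrable_F_pert[OF w'] by (simp add: smoothed_eq)
  moreover have "\<dots> \<le> K * vnorm n (\<lambda>i. w i - w' i)"
    using integrable_F_pert[OF w] integrable_F_pert[OF w'] pt
    by (intro P.integral_le_const) (auto simp: abs_le_iff intro!: AE_I2)
  moreover have "- (K * vnorm n (\<lambda>i. w i - w' i)) \<le>
      (\<integral>p. F (\<lambda>i. w i + \<mu> * u p i) (fst p) - F (\<lambda>i. w' i + \<mu> * u p i) (fst p) \<partial>D)"
    using integrable_F_pert[OF w] integrable_F_pert[OF w'] pt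
    by (intro P.integral_ge_const) (force simp: abs_le_iff intro!: AE_I2)+
  ultimately show "\<bar>fs w - fs w'\<bar> \<le> K * vnorm n (\<lambda>i. w i - w' i)" by (simp add: abs_le_iff)
qed

lemma grad_lipschitz:
  assumes i: "i < n"
  shows "lipschitz_Rn n (2 * K / \<mu>) (\<lambda>w. grad w i)"
  unfolding lipschitz_Rn_def
proof (intro ballI)
  fix w w' assume w: "w \<in> Rn n" and w': "w' \<in> Rn n"
  let ?V = "vnorm n (\<lambda>i. w i - w' i)"
  have pt: "\<bar>s w p i - s w' p i\<bar> \<le> 2 * K / \<mu> * ?V * \<bar>u p i\<bar>" if p: "p \<in> space D" for p
  proof -
    let ?x = "fst p"
    let ?d = "F (\<lambda>i. w i + \<mu> * u p i) ?x - F (\<lambda>i. w' i + \<mu> * u p i) ?x - (F w ?x - F w' ?x)"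
    have "\<bar>F (\<lambda>i. w i + \<mu> * u p i) ?x - F (\<lambda>i. w' i + \<mu> * u p i) ?x\<bar> \<le> K * ?V"
      using F_lipschitz[OF space_D[OF p]] Rn_pert[OF w, of \<mu> p] Rn_pert[OF w', of \<mu> p]
      unfolding lipschitz_Rn_def by fastforce
    moreover have "\<bar>F w ?x - F w' ?x\<bar> \<le> K * ?V"
      using F_lipschitz[OF space_D[OF p]] w w' unfolding lipschitz_Rn_def by blast
    ultimately have d: "\<bar>?d\<bar> \<le> 2 * K * ?V" by linarith
    have "s w p i - s w' p i = ?d / \<mu> * u p i"
      by (rule grad_est_diff)
    then have "\<bar>s w p i - s w' p i\<bar> = \<bar>?d\<bar> / \<mu> * \<bar>u p i\<bar>"
      using \<mu>_pos by (simp add: abs_mult)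
    also have "\<dots> \<le> 2 * K * ?V / \<mu> * \<bar>u p i\<bar>"
      using d \<mu>_pos by (intro mult_right_mono divide_right_mono) auto
    finally show ?thesis by simp
  qed
  have "\<bar>grad w i - grad w' i\<bar> = \<bar>\<integral>p. s w p i - s w' p i \<partial>D\<bar>"
    by (simp add: grad_def integrable_grad_est w w')
  also have "\<dots> \<le> (\<integral>p. \<bar>s w p i - s w' p i\<bar> \<partial>D)" by (rule integral_abs_bound)
  also have "\<dots> \<le> (\<integral>p. 2 * K / \<mu> * ?V * \<bar>u p i\<bar> \<partial>D)"
    using pt u_abs(1)[OF i] integrable_grad_est w w' by (intro integral_mono) auto
  also have "\<dots> = 2 * K / \<mu> * ?V * (\<integral>p. \<bar>u p i\<bar> \<partial>D)" by simp
  also have "\<dots> \<le> 2 * K / \<mu> * ?V * 1"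
    using u_abs(2)[OF i] \<pi>_bounds(2)[OF i] K_pos \<mu>_pos by (intro mult_left_mono) auto
  finally show "\<bar>grad w i - grad w' i\<bar> \<le> 2 * K / \<mu> * ?V" by simp
qed

text \<open>Besides entering the Lipschitz constant of \<open>grad_sq\<close>, this shows that the
  gradient vanishes everywhere when \<open>m\<close> is 0.\<close>

lemma grad_bound:
  assumes w: "w \<in> Rn n"
  shows "\<bar>grad w i\<bar> \<le> K * m"
proof (cases "i < n")
  case True
  have "\<bar>grad w i\<bar> \<le> (\<integral>p. \<bar>s w p i\<bar> \<partial>D)" unfolding grad_def by (rule integral_abs_bound)
  also have "\<dots> \<le> (\<integral>p. K * (vnorm n (u p))\<^sup>2 \<partial>D)"
  proof (intro integral_mono)
    fix p assume p: "p \<in> space D"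
    have "\<bar>s w p i\<bar> \<le> K * vnorm n (u p) * \<bar>u p i\<bar>" by (rule grad_est_bound[OF p w])
    also have "\<dots> \<le> K * vnorm n (u p) * vnorm n (u p)"
      using K_pos by (intro mult_left_mono abs_le_vnorm True) auto
    finally show "\<bar>s w p i\<bar> \<le> K * (vnorm n (u p))\<^sup>2" by (simp add: power2_eq_square mult_ac)
  qed (use integrable_grad_est[OF w] u_norm_square in auto)
  finally show ?thesis using u_norm_square by simp
next
  case False
  then show ?thesis using grad_Rn[of w] K_pos m_nonneg by (simp add: Rn_def)
qed

lemma grad_est_norm:
  assumes p: "p \<in> space D" and w: "w \<in> Rn n"
  shows "vnorm n (s w p) \<le> K * (vnorm n (u p))\<^sup>2"
proof -
  have "\<bar>(F (\<lambda>j. w j + \<mu> * u p j) (fst p) - F w (fst p)) / \<mu>\<bar> \<le> K * vnorm n (u p)"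
    using F_pert_bound[OF p w] \<mu>_pos by (simp add: abs_divide pos_divide_le_eq mult_ac)
  then have "vnorm n (s w p) \<le> K * vnorm n (u p) * vnorm n (u p)"
    unfolding grad_est_def vnorm_scale by (intro mult_right_mono) auto
  then show ?thesis by (simp add: power2_eq_square mult_ac)
qed

text \<open>By \<open>u_fourth\<close> each coordinate of the estimator has second moment at most
  \<open>3 * K\<^sup>2 * m\<close>. The weights \<open>\<pi> i\<close> of \<open>q\<close> sum to
  \<open>m\<close>, which supplies the second factor \<open>m\<close> where an unweighted sum over
  the coordinates would give \<open>n\<close>.\<close>

lemma grad_est_q:
  assumes w: "w \<in> Rn n"
  shows "integrable D (\<lambda>p. q (s w p))" and "(\<integral>p. q (s w p) \<partial>D) \<le> 3 * K\<^sup>2 * m\<^sup>2"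
proof -
  let ?B = "\<lambda>i p. K\<^sup>2 * (\<Sum>j<n. (u p i)\<^sup>2 * (u p j)\<^sup>2)"
  have B: "integrable D (?B i)" if "i < n" for i
    by (intro integrable_mult_right Bochner_Integration.integrable_sum u_fourth) (use that in auto)
  have pt: "(s w p i)\<^sup>2 \<le> ?B i p" if p: "p \<in> space D" for p i
  proof -
    have "(s w p i)\<^sup>2 \<le> (K * vnorm n (u p) * \<bar>u p i\<bar>)\<^sup>2"
      using power_mono[OF grad_est_bound[OF p w, of i], of 2] by simp
    also have "\<dots> = ?B i p" by (simp add: power_mult_distrib vnorm_sq sum_distrib_left mult_ac)
    finally show ?thesis .
  qed
  have int: "integrable D (\<lambda>p. (s w p i)\<^sup>2)" if "i < n" for i
  proof (rule Bochner_Integration.integrable_bound[OF B[OF that]])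
    show "(\<lambda>p. (s w p i)\<^sup>2) \<in> borel_measurable D"
      using grad_est_measurable[OF w] by measurable
    show "AE p in D. norm ((s w p i)\<^sup>2) \<le> norm (?B i p)"
      unfolding real_norm_def abs_power2 by (intro AE_I2 order_trans[OF pt abs_ge_self])
  qed
  have i2: "(\<integral>p. (s w p i)\<^sup>2 \<partial>D) \<le> 3 * K\<^sup>2 * m" if i: "i < n" for i
  proof -
    have "(\<integral>p. (s w p i)\<^sup>2 \<partial>D) \<le> (\<integral>p. ?B i p \<partial>D)"
      by (rule integral_mono[OF int[OF i] B[OF i] pt])
    also have "\<dots> = K\<^sup>2 * (\<Sum>j<n. \<integral>p. (u p i)\<^sup>2 * (u p j)\<^sup>2 \<partial>D)"
      using i by (simp add: Bochner_Integration.integral_sum u_fourth)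
    also have "\<dots> \<le> K\<^sup>2 * (\<Sum>j<n. 3 * \<pi> j)"
      using i by (intro mult_left_mono sum_mono u_fourth) auto
    also have "\<dots> = 3 * K\<^sup>2 * m" by (simp add: m_def sum_distrib_left mult_ac)
    finally show ?thesis .
  qed
  show "integrable D (\<lambda>p. q (s w p))"
    unfolding q_def by (intro Bochner_Integration.integrable_sum integrable_mult_right int) auto
  have "(\<integral>p. q (s w p) \<partial>D) = (\<Sum>i<n. \<pi> i * (\<integral>p. (s w p i)\<^sup>2 \<partial>D))"
    unfolding q_def by (simp add: Bochner_Integration.integral_sum int)
  also have "\<dots> \<le> (\<Sum>i<n. \<pi> i * (3 * K\<^sup>2 * m))"
    using i2 \<pi>_bounds by (intro sum_mono mult_left_mono) auto
  also have "\<dots> = 3 * K\<^sup>2 * m\<^sup>2" by (simp add: m_def sum_distrib_right[symmetric] power2_eq_square)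
  finally show "(\<integral>p. q (s w p) \<partial>D) \<le> 3 * K\<^sup>2 * m\<^sup>2" .
qed

section \<open>One step of the algorithm from a fixed point\<close>

definition step :: "real \<Rightarrow> vec \<Rightarrow> 'x \<times> vec \<Rightarrow> vec" where
  "step h w p = (\<lambda>i. w i - h * s w p i)"

lemma step_Rn: "w \<in> Rn n \<Longrightarrow> step h w p \<in> Rn n"
  using grad_est_Rn[of w p] by (simp add: step_def Rn_def)

lemma step_measurable: "w \<in> Rn n \<Longrightarrow> (\<lambda>p. step h w p i) \<in> borel_measurable D"
  unfolding step_def using grad_est_measurable by measurable

lemma step_dist:
  assumes "p \<in> space D" "w \<in> Rn n" "0 < h"
  shows "vnorm n (\<lambda>i. step h w p i - w i) \<le> h * (K * (vnorm n (u p))\<^sup>2)"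
proof -
  have "(\<lambda>i. step h w p i - w i) = (\<lambda>i. (- h) * s w p i)" by (auto simp: step_def)
  then have "vnorm n (\<lambda>i. step h w p i - w i) = h * vnorm n (s w p)"
    using assms(3) by (simp only: vnorm_scale)
  then show ?thesis using grad_est_norm[OF assms(1,2)] assms(3) by simp
qed

text \<open>One step moves the point by at most \<open>h * K\<close> times the squared norm of the
  perturbation, whose mean is \<open>m\<close>. The sign of \<open>L\<close> is not fixed, hence the
  absolute value.\<close>

lemma step_comp:
  assumes g: "lipschitz_Rn n L g" and w: "w \<in> Rn n" and h: "0 < h"
  shows "integrable D (\<lambda>p. g (step h w p))"
    and "(\<integral>p. \<bar>g (step h w p) - g w\<bar> \<partial>D) \<le> \<bar>L\<bar> * h * K * m"
proof -
  have meas: "(\<lambda>p. g (step h w p)) \<in> borel_measurable D"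
    by (rule borel_measurable_lipschitz_comp[of n "\<lambda>w _. g w" D L "step h w"])
      (use g step_Rn[OF w] step_measurable[OF w] in auto)
  have pt: "\<bar>g (step h w p) - g w\<bar> \<le> \<bar>L\<bar> * h * K * (vnorm n (u p))\<^sup>2" if p: "p \<in> space D" for p
  proof -
    have "\<bar>g (step h w p) - g w\<bar> \<le> L * vnorm n (\<lambda>i. step h w p i - w i)"
      using g step_Rn[OF w] w by (simp add: lipschitz_Rn_def)
    also have "\<dots> \<le> \<bar>L\<bar> * (h * (K * (vnorm n (u p))\<^sup>2))"
      by (intro mult_mono step_dist[OF p w h]) auto
    finally show ?thesis by (simp add: mult_ac)
  qed
  have int: "integrable D (\<lambda>p. g (step h w p) - g w)"
  proof (rule Bochner_Integration.integrable_bound[OF integrable_mult_right[OF u_norm_square(1)]])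
    show "AE p in D. norm (g (step h w p) - g w) \<le> norm (\<bar>L\<bar> * h * K * (vnorm n (u p))\<^sup>2)"
      unfolding real_norm_def by (intro AE_I2 order_trans[OF pt abs_ge_self])
  qed (use meas in simp)
  show "integrable D (\<lambda>p. g (step h w p))"
    using Bochner_Integration.integrable_add[OF int, of "\<lambda>_. g w"] by simp
  have "(\<integral>p. \<bar>g (step h w p) - g w\<bar> \<partial>D) \<le> (\<integral>p. \<bar>L\<bar> * h * K * (vnorm n (u p))\<^sup>2 \<partial>D)"
    using int pt u_norm_square by (intro integral_mono) auto
  then show "(\<integral>p. \<bar>g (step h w p) - g w\<bar> \<partial>D) \<le> \<bar>L\<bar> * h * K * m"
    using u_norm_square by simp
qed

definition grad_sq :: "vec \<Rightarrow> real" where "grad_sq w = (vnorm n (grad w))\<^sup>2"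

text \<open>\<open>smoothed_descent\<close> at the increment \<open>- h * s\<close>, averaged over
  the draw. The linear term becomes \<open>- h * grad_sq w\<close> because the estimator has mean
  \<open>grad w\<close>; the constant 6 is the 2 of the curvature bound times the 3 of
  \<open>grad_est_q\<close>.\<close>

lemma step_descent:
  assumes w: "w \<in> Rn n" and h: "0 < h"
  shows "(\<integral>p. fs (step h w p) \<partial>D) + h * grad_sq w \<le> fs w + h\<^sup>2 * (6 * K ^ 3 * m\<^sup>2 / \<mu>)"
proof -
  let ?v = "\<lambda>p i. (- h) * s w p i"
  have v: "?v p \<in> Rn n" for p using grad_est_Rn[of w p] by (simp add: Rn_def)
  have st: "step h w p = (\<lambda>i. w i + ?v p i)" for p by (auto simp: step_def)
  have qh: "q (?v p) = h\<^sup>2 * q (s w p)" for p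
    by (simp add: q_def sum_distrib_left power_mult_distrib mult_ac)
  have iv: "vinner n (grad w) (?v p) = - h * (\<Sum>i<n. grad w i * s w p i)" for p
    by (simp add: vinner_def sum_distrib_left sum_negf mult_ac)
  have pt: "fs (step h w p) \<le> fs w + - h * (\<Sum>i<n. grad w i * s w p i) + 2 * K / \<mu> * (h\<^sup>2 * q (s w p))" for p
    using smoothed_descent[OF w v, of p] unfolding st iv qh .
  have i1: "integrable D (\<lambda>p. \<Sum>i<n. grad w i * s w p i)"
    by (intro Bochner_Integration.integrable_sum integrable_mult_right integrable_grad_est w)
  have v1: "(\<integral>p. (\<Sum>i<n. grad w i * s w p i) \<partial>D) = grad_sq w"
    using grad_inner[OF w, of "grad w"] unfolding grad_sq_def vnorm_sq
    by (simp add: vinner_def power2_eq_square)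
  have "(\<integral>p. fs (step h w p) \<partial>D) \<le>
      (\<integral>p. fs w + - h * (\<Sum>i<n. grad w i * s w p i) + 2 * K / \<mu> * (h\<^sup>2 * q (s w p)) \<partial>D)"
    using step_comp(1)[OF smoothed_lipschitz w h] i1 grad_est_q(1)[OF w] pt
    by (intro integral_mono) auto
  also have "\<dots> = fs w - h * grad_sq w + 2 * K / \<mu> * (h\<^sup>2 * (\<integral>p. q (s w p) \<partial>D))"
    using i1 grad_est_q(1)[OF w] v1 P.prob_space by simp
  also have "\<dots> \<le> fs w - h * grad_sq w + 2 * K / \<mu> * (h\<^sup>2 * (3 * K\<^sup>2 * m\<^sup>2))"
    using grad_est_q(2)[OF w] K_pos \<mu>_pos by (intro add_left_mono mult_left_mono) auto
  finally show ?thesis by (simp add: power2_eq_square power3_eq_cube mult_ac)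
qed

text \<open>Each coordinate uses the difference of squares: the Lipschitz constant
  \<open>2 * K / \<mu>\<close> of the gradient entry times the bound \<open>2 * K * m\<close> on the
  sum. The factor \<open>n\<close> ends up in the late learning rates and not in the number of
  iterations.\<close>

lemma grad_sq_lipschitz: "lipschitz_Rn n (real n * (4 * K\<^sup>2 * m / \<mu>)) grad_sq"
proof -
  define L where "L = 4 * K\<^sup>2 * m / \<mu>"
  have lip: "lipschitz_Rn n L (\<lambda>w. (grad w i)\<^sup>2)" if i: "i < n" for i
    unfolding lipschitz_Rn_def
  proof (intro ballI)
    fix w w' assume w: "w \<in> Rn n" and w': "w' \<in> Rn n"
    have "\<bar>(grad w i)\<^sup>2 - (grad w' i)\<^sup>2\<bar> = \<bar>grad w i - grad w' i\<bar> * \<bar>grad w i + grad w' i\<bar>"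
      by (simp add: abs_mult[symmetric] power2_eq_square algebra_simps)
    also have "\<dots> \<le> (2 * K / \<mu> * vnorm n (\<lambda>i. w i - w' i)) * (2 * K * m)"
    proof (intro mult_mono)
      show "\<bar>grad w i - grad w' i\<bar> \<le> 2 * K / \<mu> * vnorm n (\<lambda>i. w i - w' i)"
        using grad_lipschitz[OF i] w w' by (simp add: lipschitz_Rn_def)
      show "\<bar>grad w i + grad w' i\<bar> \<le> 2 * K * m"
        using grad_bound[OF w, of i] grad_bound[OF w', of i] by linarith
    qed (use K_pos \<mu>_pos in auto)
    finally show "\<bar>(grad w i)\<^sup>2 - (grad w' i)\<^sup>2\<bar> \<le> L * vnorm n (\<lambda>i. w i - w' i)"
      by (simp add: L_def power2_eq_square mult_ac)
  qed
  show ?thesis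
    unfolding lipschitz_Rn_def grad_sq_def vnorm_sq L_def[symmetric]
  proof (intro ballI)
    fix w w' assume w: "w \<in> Rn n" and w': "w' \<in> Rn n"
    have "\<bar>(\<Sum>i<n. (grad w i)\<^sup>2) - (\<Sum>i<n. (grad w' i)\<^sup>2)\<bar> \<le> (\<Sum>i<n. \<bar>(grad w i)\<^sup>2 - (grad w' i)\<^sup>2\<bar>)"
      unfolding sum_subtractf[symmetric] by (rule sum_abs)
    also have "\<dots> \<le> (\<Sum>i<n. L * vnorm n (\<lambda>i. w i - w' i))"
      using lip w w' by (intro sum_mono) (simp add: lipschitz_Rn_def)
    finally show "\<bar>(\<Sum>i<n. (grad w i)\<^sup>2) - (\<Sum>i<n. (grad w' i)\<^sup>2)\<bar>
        \<le> real n * L * vnorm n (\<lambda>i. w i - w' i)" by simp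
  qed
qed

lemma step_grad_sq:
  assumes w: "w \<in> Rn n" and h: "0 < h"
  shows "integrable D (\<lambda>p. grad_sq (step h w p))"
    and "(\<integral>p. grad_sq (step h w p) \<partial>D) \<le> grad_sq w + h * (4 * K ^ 3 * m\<^sup>2 * real n / \<mu>)"
proof -
  define L where "L = 4 * K\<^sup>2 * m / \<mu>"
  have L0: "0 \<le> L" using K_pos \<mu>_pos m_nonneg by (simp add: L_def)
  note lipg = grad_sq_lipschitz[folded L_def]
  show int: "integrable D (\<lambda>p. grad_sq (step h w p))" by (rule step_comp(1)[OF lipg w h])
  have "(\<integral>p. grad_sq (step h w p) \<partial>D) - grad_sq w = (\<integral>p. grad_sq (step h w p) - grad_sq w \<partial>D)"
    using int P.prob_space by simp
  also have "\<dots> \<le> (\<integral>p. \<bar>grad_sq (step h w p) - grad_sq w\<bar> \<partial>D)"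
    using int by (intro integral_mono) auto
  also have "\<dots> \<le> \<bar>real n * L\<bar> * h * K * m" by (rule step_comp(2)[OF lipg w h])
  also have "\<dots> = h * (4 * K ^ 3 * m\<^sup>2 * real n / \<mu>)"
  proof -
    have "\<bar>real n * L\<bar> = real n * L" using L0 by simp
    then show ?thesis by (simp add: L_def power2_eq_square power3_eq_cube mult_ac)
  qed
  finally show "(\<integral>p. grad_sq (step h w p) \<partial>D) \<le> grad_sq w + h * (4 * K ^ 3 * m\<^sup>2 * real n / \<mu>)" by simp
qed

text \<open>A bound on the objective does not transfer directly, as the law of the sparse
  perturbation depends on \<open>x\<close>. But \<open>F\<close> ignores inactive coordinates, so
  the full Gaussian vector, independent of \<open>x\<close>, may be used instead. Fubini then shows
  that the smoothed function is the Gaussian average of the objective at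
  \<open>w + \<mu> * z\<close>.\<close>

lemma smoothed_ge:
  assumes f: "\<And>w. w \<in> Rn n \<Longrightarrow> c \<le> objective M F w" and w: "w \<in> Rn n"
  shows "c \<le> fs w"
proof -
  let ?w = "\<lambda>z i. w i + \<mu> * (if i < n then z i else 0)"
  have R: "?w z \<in> Rn n" for z using w by (simp add: Rn_def)
  have eq: "F (\<lambda>i. w i + \<mu> * u p i) (fst p) = F (?w (snd p)) (fst p)" if p: "p \<in> space D" for p
  proof -
    have "\<bar>F (\<lambda>i. w i + \<mu> * u p i) (fst p) - F (?w (snd p)) (fst p)\<bar>
        \<le> K * sqrt (\<Sum>i\<in>A (fst p). (w i + \<mu> * u p i - ?w (snd p) i)\<^sup>2)"
      by (rule lip_active[OF space_D[OF p] Rn_pert[OF w] R])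
    also have "(\<Sum>i\<in>A (fst p). (w i + \<mu> * u p i - ?w (snd p) i)\<^sup>2) = 0"
      by (intro sum.neutral) (auto simp: sparse_pert_def active_def)
    finally have "\<bar>F (\<lambda>i. w i + \<mu> * u p i) (fst p) - F (?w (snd p)) (fst p)\<bar> \<le> 0"
      by (simp only: real_sqrt_zero mult_zero_right)
    then show ?thesis by linarith
  qed
  have int: "integrable D (\<lambda>(x, z). F (?w z) x)"
    using integrable_F_pert[OF w] by (subst Bochner_Integration.integrable_cong[OF refl, symmetric])
      (auto simp: split_beta dest: eq)
  have "fs w = (\<integral>p. (case p of (x, z) \<Rightarrow> F (?w z) x) \<partial>D)"
    unfolding smoothed_eq by (rule Bochner_Integration.integral_cong[OF refl]) (simp add: split_beta eq)
  also have "\<dots> = (\<integral>z. (\<integral>x. F (?w z) x \<partial>M) \<partial>gauss {..<n})"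
    by (rule P.integral_snd[OF int, symmetric])
  also have "\<dots> \<ge> c"
    using P.integrable_snd[OF int] f[OF R]
    by (intro prob_space.integral_ge_const[OF prob_space_gauss]) (auto simp: objective_def)
  finally show ?thesis .
qed

subsection \<open>Expectations along the iterates\<close>

abbreviation it :: "(nat \<Rightarrow> real) \<Rightarrow> nat \<Rightarrow> (nat \<Rightarrow> 'x \<times> vec) \<Rightarrow> vec" where
  "it \<equiv> iterate n Y \<phi> F \<mu>"

sublocale Q: product_sigma_finite "\<lambda>_ :: nat. D"
  by (simp add: product_sigma_finite_def P.sigma_finite_measure_axioms)

lemma it_0: "it h 0 \<omega> = (\<lambda>_. 0)"
  by (simp add: iterate_def)

lemma it_Suc: "it h (Suc k) \<omega> = step (h k) (it h k \<omega>) (\<omega> k)"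
  by (simp add: iterate_def step_def)

lemma it_Rn: "it h k \<omega> \<in> Rn n"
  by (induction k) (simp_all add: it_0 it_Suc step_Rn, simp add: Rn_def)

text \<open>Adaptedness: draw \<open>k\<close> is fresh for iterate \<open>k\<close> and can be
  integrated out while the iterate is held fixed.\<close>

lemma it_cong: "(\<And>j. j < k \<Longrightarrow> \<omega> j = \<omega>' j) \<Longrightarrow> it h k \<omega> = it h k \<omega>'"
  by (induction k) (simp_all add: it_0 it_Suc)

lemma it_cong_rate: "(\<And>j. j < k \<Longrightarrow> h j = h' j) \<Longrightarrow> it h k \<omega> = it h' k \<omega>"
  by (induction k) (simp_all add: it_0 it_Suc)

lemma it_measurable: "{..<k} \<subseteq> J \<Longrightarrow> (\<lambda>\<omega>. it h k \<omega> i) \<in> borel_measurable (\<Pi>\<^sub>M j\<in>J. D)"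
proof (induction k arbitrary: i)
  case 0
  then show ?case by (simp add: it_0)
next
  case (Suc k)
  then have k: "k \<in> J" and "{..<k} \<subseteq> J" by auto
  note IH = Suc.IH[OF this(2)]
  have c: "(\<lambda>\<omega>. \<omega> k) \<in> measurable (\<Pi>\<^sub>M j\<in>J. D) D"
    using k by (rule measurable_component_singleton)
  have X: "(\<lambda>\<omega>. fst (\<omega> k)) \<in> measurable (\<Pi>\<^sub>M j\<in>J. D) M"
    by (rule measurable_compose[OF c measurable_fst])
  have U: "(\<lambda>\<omega>. u (\<omega> k) i) \<in> borel_measurable (\<Pi>\<^sub>M j\<in>J. D)" for i
    by (rule measurable_compose[OF c u_measurable])
  have F1: "(\<lambda>\<omega>. F (it h k \<omega>) (fst (\<omega> k))) \<in> borel_measurable (\<Pi>\<^sub>M j\<in>J. D)"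
    by (intro F_measurable_comp X IH it_Rn)
  have F2: "(\<lambda>\<omega>. F (\<lambda>i. it h k \<omega> i + \<mu> * u (\<omega> k) i) (fst (\<omega> k))) \<in> borel_measurable (\<Pi>\<^sub>M j\<in>J. D)"
    by (intro F_measurable_comp X borel_measurable_add borel_measurable_times borel_measurable_const
        IH U Rn_pert it_Rn)
  show ?case
    unfolding it_Suc step_def grad_est_def using IH[of i] U[of i] F1 F2 by measurable
qed

lemma lipschitz_it_measurable:
  assumes "lipschitz_Rn n L g" and "{..<k} \<subseteq> J"
  shows "(\<lambda>\<omega>. g (it h k \<omega>)) \<in> borel_measurable (\<Pi>\<^sub>M j\<in>J. D)"
  by (rule borel_measurable_lipschitz_comp[of n "\<lambda>w _. g w" _ L "it h k"])
    (use assms it_measurable it_Rn in auto)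

text \<open>The expectation of \<open>g\<close> at iterate \<open>k\<close>, over only the draws
  that determine it. An \<open>ennreal\<close> integral needs no integrability of \<open>g\<close>
  along the iterates; negative values would be cut to 0, so it is used with functions that are
  nonnegative on \<open>Rn n\<close>.\<close>

definition expect_it :: "(nat \<Rightarrow> real) \<Rightarrow> nat \<Rightarrow> (vec \<Rightarrow> real) \<Rightarrow> ennreal" where
  "expect_it h k g = (\<integral>\<^sup>+\<omega>. ennreal (g (it h k \<omega>)) \<partial>(\<Pi>\<^sub>M j\<in>{..<k}. D))"

text \<open>The additional draw integrates to 1. This puts consecutive iterates on a common
  space.\<close>

lemma expect_it_Suc_space:
  assumes g: "lipschitz_Rn n L g"
  shows "(\<integral>\<^sup>+\<omega>. ennreal (g (it h k \<omega>)) \<partial>(\<Pi>\<^sub>M j\<in>{..<Suc k}. D)) = expect_it h k g"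
proof -
  have m: "(\<lambda>\<omega>. ennreal (g (it h k \<omega>))) \<in> borel_measurable (\<Pi>\<^sub>M j\<in>insert k {..<k}. D)"
    by (rule measurable_compose[OF lipschitz_it_measurable[OF g] measurable_ennreal]) auto
  have "it h k (fun_upd \<omega> k p) = it h k \<omega>" for \<omega> p by (rule it_cong) auto
  then show ?thesis
    unfolding lessThan_Suc expect_it_def
    by (subst Q.product_nn_integral_insert[OF _ _ m]) (simp_all add: P.emeasure_space_1)
qed

text \<open>The tower property in general form: an inequality for one step from every fixed
  \<open>w\<close> is integrated over the law of iterate \<open>k\<close>. It yields both the
  descent inequality and the slow growth of \<open>grad_sq\<close>.\<close>

lemma expect_it_step:
  assumes g: "lipschitz_Rn n L1 g1" "lipschitz_Rn n L2 g2" "lipschitz_Rn n L3 g3"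
    and step: "\<And>w. w \<in> Rn n \<Longrightarrow>
      (\<integral>\<^sup>+p. ennreal (g1 (step (h k) w p)) + ennreal (g2 w) \<partial>D) \<le> ennreal (g3 w) + ennreal c"
  shows "expect_it h (Suc k) g1 + expect_it h k g2 \<le> expect_it h k g3 + ennreal c"
proof -
  interpret W: prob_space "\<Pi>\<^sub>M j\<in>{..<k}. D"
    by (intro prob_space_PiM P.prob_space_axioms)
  have m: "(\<lambda>\<omega>. ennreal (g1 (it h (Suc k) \<omega>)) + ennreal (g2 (it h k \<omega>)))
      \<in> borel_measurable (\<Pi>\<^sub>M j\<in>insert k {..<k}. D)"
    by (intro borel_measurable_add measurable_compose[OF _ measurable_ennreal]
        lipschitz_it_measurable[OF g(1)] lipschitz_it_measurable[OF g(2)]) auto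
  have cong: "it h k (fun_upd \<omega> k p) = it h k \<omega>" for \<omega> p by (rule it_cong) auto
  have "expect_it h (Suc k) g1 + expect_it h k g2 =
      (\<integral>\<^sup>+\<omega>. ennreal (g1 (it h (Suc k) \<omega>)) + ennreal (g2 (it h k \<omega>)) \<partial>(\<Pi>\<^sub>M j\<in>{..<Suc k}. D))"
    unfolding expect_it_Suc_space[OF g(2), symmetric] unfolding expect_it_def
    by (intro nn_integral_add[symmetric] measurable_compose[OF _ measurable_ennreal]
        lipschitz_it_measurable[OF g(1)] lipschitz_it_measurable[OF g(2)]) auto
  also have "\<dots> = (\<integral>\<^sup>+\<omega>. (\<integral>\<^sup>+p. ennreal (g1 (step (h k) (it h k \<omega>) p)) + ennreal (g2 (it h k \<omega>)) \<partial>D)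
      \<partial>(\<Pi>\<^sub>M j\<in>{..<k}. D))"
    unfolding lessThan_Suc
    by (subst Q.product_nn_integral_insert[OF _ _ m]) (simp_all add: it_Suc cong)
  also have "\<dots> \<le> (\<integral>\<^sup>+\<omega>. ennreal (g3 (it h k \<omega>)) + ennreal c \<partial>(\<Pi>\<^sub>M j\<in>{..<k}. D))"
    by (intro nn_integral_mono step it_Rn)
  also have "\<dots> = expect_it h k g3 + ennreal c"
    unfolding expect_it_def
    by (subst nn_integral_add) (auto simp: W.emeasure_space_1 intro!: measurable_compose[OF _ measurable_ennreal]
        lipschitz_it_measurable[OF g(3)])
  finally show ?thesis .
qed

lemma grad_sq_nonneg: "0 \<le> grad_sq w"
  by (simp add: grad_sq_def)

lemma expect_it_grad_sq_step:
  assumes h: "0 < h k"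
  shows "expect_it h (Suc k) grad_sq \<le> expect_it h k grad_sq + ennreal (h k * (4 * K ^ 3 * m\<^sup>2 * real n / \<mu>))"
proof -
  have Q0: "0 \<le> h k * (4 * K ^ 3 * m\<^sup>2 * real n / \<mu>)" using h K_pos \<mu>_pos by simp
  \<comment> \<open>No decrease is tracked here, so the second function of the general step is taken
    to be zero.\<close>
  have z: "lipschitz_Rn n 0 (\<lambda>_. 0)" by (simp add: lipschitz_Rn_def)
  have "expect_it h (Suc k) grad_sq + expect_it h k (\<lambda>_. 0)
      \<le> expect_it h k grad_sq + ennreal (h k * (4 * K ^ 3 * m\<^sup>2 * real n / \<mu>))"
  proof (rule expect_it_step[OF grad_sq_lipschitz z grad_sq_lipschitz])
    fix w assume w: "w \<in> Rn n"
    have "(\<integral>\<^sup>+p. ennreal (grad_sq (step (h k) w p)) + ennreal 0 \<partial>D) = ennreal (\<integral>p. grad_sq (step (h k) w p) \<partial>D)"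
      using step_grad_sq(1)[OF w h] grad_sq_nonneg by (simp add: nn_integral_eq_integral)
    also have "\<dots> \<le> ennreal (grad_sq w + h k * (4 * K ^ 3 * m\<^sup>2 * real n / \<mu>))"
      by (intro ennreal_leI step_grad_sq(2) w h)
    finally show "(\<integral>\<^sup>+p. ennreal (grad_sq (step (h k) w p)) + ennreal 0 \<partial>D)
        \<le> ennreal (grad_sq w) + ennreal (h k * (4 * K ^ 3 * m\<^sup>2 * real n / \<mu>))"
      using Q0 grad_sq_nonneg by (simp add: ennreal_plus)
  qed
  then show ?thesis by (simp add: expect_it_def)
qed

text \<open>Subtracting \<open>fstar\<close> makes the function nonnegative by
  \<open>smoothed_ge\<close>, so that its passage to \<open>ennreal\<close> loses nothing.\<close>

lemma expect_it_descent:
  assumes f: "\<And>w. w \<in> Rn n \<Longrightarrow> fstar \<le> objective M F w" and h: "0 < h k"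
  shows "expect_it h (Suc k) (\<lambda>w. fs w - fstar) + ennreal (h k) * expect_it h k grad_sq
    \<le> expect_it h k (\<lambda>w. fs w - fstar) + ennreal ((h k)\<^sup>2 * (6 * K ^ 3 * m\<^sup>2 / \<mu>))"
proof -
  let ?c = "(h k)\<^sup>2 * (6 * K ^ 3 * m\<^sup>2 / \<mu>)"
  have c0: "0 \<le> ?c" using K_pos \<mu>_pos by simp
  have l1: "lipschitz_Rn n K (\<lambda>w. fs w - fstar)"
    using smoothed_lipschitz by (simp add: lipschitz_Rn_def)
  obtain L where L: "lipschitz_Rn n L grad_sq" using grad_sq_lipschitz by blast
  have l2: "lipschitz_Rn n (h k * L) (\<lambda>w. h k * grad_sq w)"
    using L h by (simp add: lipschitz_Rn_def right_diff_distrib[symmetric] abs_mult mult.assoc)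
  have nn: "0 \<le> fs w - fstar" if "w \<in> Rn n" for w
    using smoothed_ge[of fstar w] f that by simp
  have "expect_it h (Suc k) (\<lambda>w. fs w - fstar) + expect_it h k (\<lambda>w. h k * grad_sq w)
      \<le> expect_it h k (\<lambda>w. fs w - fstar) + ennreal ?c"
  proof (rule expect_it_step[OF l1 l2 l1])
    fix w assume w: "w \<in> Rn n"
    have i: "integrable D (\<lambda>p. fs (step (h k) w p))" by (rule step_comp(1)[OF smoothed_lipschitz w h])
    have "(\<integral>\<^sup>+p. ennreal (fs (step (h k) w p) - fstar) + ennreal (h k * grad_sq w) \<partial>D)
        = (\<integral>\<^sup>+p. ennreal (fs (step (h k) w p) - fstar + h k * grad_sq w) \<partial>D)"
      using nn[OF step_Rn[OF w]] grad_sq_nonneg h by (simp add: ennreal_plus)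
    also have "\<dots> = ennreal (\<integral>p. fs (step (h k) w p) - fstar + h k * grad_sq w \<partial>D)"
      using i nn[OF step_Rn[OF w]] grad_sq_nonneg[of w] h
      by (intro nn_integral_eq_integral) (auto intro!: AE_I2 add_nonneg_nonneg)
    also have "(\<integral>p. fs (step (h k) w p) - fstar + h k * grad_sq w \<partial>D)
        = (\<integral>p. fs (step (h k) w p) \<partial>D) - fstar + h k * grad_sq w"
      using i P.prob_space by simp
    also have "ennreal \<dots> \<le> ennreal (fs w - fstar + ?c)"
      using step_descent[OF w h] by (intro ennreal_leI) simp
    also have "\<dots> = ennreal (fs w - fstar) + ennreal ?c"
      using nn[OF w] c0 by (rule ennreal_plus)
    finally show "(\<integral>\<^sup>+p. ennreal (fs (step (h k) w p) - fstar) + ennreal (h k * grad_sq w) \<partial>D)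
        \<le> ennreal (fs w - fstar) + ennreal ?c" .
  qed
  moreover have "expect_it h k (\<lambda>w. h k * grad_sq w) = ennreal (h k) * expect_it h k grad_sq"
    unfolding expect_it_def using h grad_sq_nonneg
    by (subst nn_integral_cmult[symmetric])
      (auto simp: ennreal_mult intro!: measurable_compose[OF _ measurable_ennreal] lipschitz_it_measurable[OF L])
  ultimately show ?thesis by simp
qed

text \<open>The final gap stays on the left, and all terms are kept as sums, because subtraction in
  \<open>ennreal\<close> truncates and infinite values are not excluded beforehand.\<close>

lemma expect_it_telescope:
  assumes f: "\<And>w. w \<in> Rn n \<Longrightarrow> fstar \<le> objective M F w" and h: "0 < h"
  shows "expect_it (\<lambda>_. h) N (\<lambda>w. fs w - fstar) + (\<Sum>k<N. ennreal h * expect_it (\<lambda>_. h) k grad_sq)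
    \<le> ennreal (fs (\<lambda>_. 0) - fstar) + of_nat N * ennreal (h\<^sup>2 * (6 * K ^ 3 * m\<^sup>2 / \<mu>))"
proof (induction N)
  case 0
  interpret W: prob_space "\<Pi>\<^sub>M j\<in>{..<0 :: nat}. D"
    by (intro prob_space_PiM P.prob_space_axioms)
  show ?case by (simp add: expect_it_def it_0 W.emeasure_space_1[simplified])
next
  case (Suc N)
  let ?c = "ennreal (h\<^sup>2 * (6 * K ^ 3 * m\<^sup>2 / \<mu>))"
  let ?S = "\<Sum>k<N. ennreal h * expect_it (\<lambda>_. h) k grad_sq"
  have "expect_it (\<lambda>_. h) (Suc N) (\<lambda>w. fs w - fstar) + (\<Sum>k<Suc N. ennreal h * expect_it (\<lambda>_. h) k grad_sq)
      = (expect_it (\<lambda>_. h) (Suc N) (\<lambda>w. fs w - fstar) + ennreal h * expect_it (\<lambda>_. h) N grad_sq) + ?S"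
    by (simp add: ac_simps)
  also have "\<dots> \<le> (expect_it (\<lambda>_. h) N (\<lambda>w. fs w - fstar) + ?c) + ?S"
    using expect_it_descent[of fstar "\<lambda>_. h" N] f h by (intro add_right_mono) simp
  also have "\<dots> = (expect_it (\<lambda>_. h) N (\<lambda>w. fs w - fstar) + ?S) + ?c" by (simp add: ac_simps)
  also have "\<dots> \<le> (ennreal (fs (\<lambda>_. 0) - fstar) + of_nat N * ?c) + ?c"
    by (intro add_right_mono Suc.IH)
  also have "\<dots> = ennreal (fs (\<lambda>_. 0) - fstar) + of_nat (Suc N) * ?c"
    by (simp add: algebra_simps)
  finally show ?case .
qed

lemma expect_it_rate_cong: "(\<And>j. j < k \<Longrightarrow> h j = h' j) \<Longrightarrow> expect_it h k g = expect_it h' k g"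
  unfolding expect_it_def using it_cong_rate[of k h h'] by simp

text \<open>
  Constant steps make the average of the squared gradients small, hence some iterate \<open>k\<close> is good;
  summably small steps after \<open>k\<close> keep all later iterates good.
\<close>

lemma exists_learning_rates:
  assumes f: "\<And>w. w \<in> Rn n \<Longrightarrow> fstar \<le> objective M F w"
    and nbar: "m \<le> nbar" "0 < nbar" and \<epsilon>: "0 < \<epsilon>"
    and \<mu>: "objective M F (\<lambda>_. 0) - fstar \<le> K * \<mu> * nbar"
  shows "\<exists>h. (\<forall>k. 0 < h k) \<and>
    (\<forall>N. 200 * K ^ 4 * (nbar ^ 3 / \<epsilon>\<^sup>2) \<le> real N \<longrightarrow> expect_it h N grad_sq \<le> ennreal \<epsilon>)"
proof -
  define B where "B = 6 * K ^ 3 * nbar\<^sup>2 / \<mu>"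
  \<comment> \<open>The rate makes the noise term \<open>h0 * B\<close> equal to
    \<open>\<epsilon> / 4\<close>, half of the level \<open>\<epsilon> / 2\<close> sought for a good
    iterate.\<close>
  define h0 where "h0 = \<epsilon> / (4 * B)"
  have B: "0 < B" using K_pos \<mu>_pos nbar by (simp add: B_def)
  have h0: "0 < h0" using B \<epsilon> by (simp add: h0_def)
  have Bm: "6 * K ^ 3 * m\<^sup>2 / \<mu> \<le> B"
    unfolding B_def using K_pos \<mu>_pos nbar m_nonneg
    by (intro divide_right_mono mult_left_mono power_mono) auto
  define N0 where "N0 = nat \<lceil>200 * K ^ 4 * (nbar ^ 3 / \<epsilon>\<^sup>2)\<rceil>"
  have N0: "200 * K ^ 4 * (nbar ^ 3 / \<epsilon>\<^sup>2) \<le> real N0" unfolding N0_def by (rule real_nat_ceiling_ge)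
  have z: "(\<lambda>_. 0) \<in> Rn n" by (simp add: Rn_def)
  \<comment> \<open>One share \<open>K * \<mu> * nbar\<close> covers the gap of the objective, by
    the choice of \<mu>, and a second share covers the bias of smoothing.\<close>
  have \<Phi>0: "fs (\<lambda>_. 0) - fstar \<le> 2 * K * \<mu> * nbar"
  proof -
    have "K * \<mu> * m \<le> K * \<mu> * nbar" using K_pos \<mu>_pos nbar by simp
    then show ?thesis using smoothed_le[OF z] \<mu> by linarith
  qed
  \<comment> \<open>Otherwise the telescoped inequality would bound
    \<open>N0 * h0 * \<epsilon> / 2\<close> by the initial gap plus
    \<open>N0 * h0 * \<epsilon> / 4\<close>, which fails for this \<open>N0\<close>.\<close>
  have "\<exists>k<N0. expect_it (\<lambda>_. h0) k grad_sq \<le> ennreal (\<epsilon> / 2)"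
  proof (rule ccontr)
    assume "\<not> ?thesis"
    then have large: "ennreal (\<epsilon> / 2) \<le> expect_it (\<lambda>_. h0) k grad_sq" if "k < N0" for k
      using that by (meson linorder_not_le order_less_imp_le)
    have "ennreal (real N0 * (h0 * (\<epsilon> / 2))) = (\<Sum>k<N0. ennreal h0 * ennreal (\<epsilon> / 2))"
    proof -
      have "ennreal (real N0 * (h0 * (\<epsilon> / 2))) = ennreal (real N0) * ennreal (h0 * (\<epsilon> / 2))"
        using h0 \<epsilon> by (intro ennreal_mult) auto
      moreover have "ennreal (h0 * (\<epsilon> / 2)) = ennreal h0 * ennreal (\<epsilon> / 2)"
        using h0 \<epsilon> by (intro ennreal_mult) auto
      ultimately show ?thesis by (simp only: sum_constant card_lessThan ennreal_of_nat_eq_real_of_nat)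
    qed
    also have "\<dots> \<le> (\<Sum>k<N0. ennreal h0 * expect_it (\<lambda>_. h0) k grad_sq)"
      using large by (intro sum_mono mult_left_mono) auto
    also have "\<dots> \<le> expect_it (\<lambda>_. h0) N0 (\<lambda>w. fs w - fstar) + \<dots>" by simp
    also have "\<dots> \<le> ennreal (fs (\<lambda>_. 0) - fstar) + of_nat N0 * ennreal (h0\<^sup>2 * (6 * K ^ 3 * m\<^sup>2 / \<mu>))"
      by (rule expect_it_telescope[OF f h0])
    also have "\<dots> \<le> ennreal (2 * K * \<mu> * nbar) + of_nat N0 * ennreal (h0\<^sup>2 * B)"
      using \<Phi>0 Bm h0 by (intro add_mono mult_left_mono ennreal_leI) auto
    also have "\<dots> = ennreal (2 * K * \<mu> * nbar + real N0 * (h0\<^sup>2 * B))"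
    proof -
      have "ennreal (real N0 * (h0\<^sup>2 * B)) = ennreal (real N0) * ennreal (h0\<^sup>2 * B)"
        using B by (intro ennreal_mult) auto
      moreover have "ennreal (2 * K * \<mu> * nbar + real N0 * (h0\<^sup>2 * B))
          = ennreal (2 * K * \<mu> * nbar) + ennreal (real N0 * (h0\<^sup>2 * B))"
        using K_pos \<mu>_pos nbar B by (intro ennreal_plus) auto
      ultimately show ?thesis by (simp only: ennreal_of_nat_eq_real_of_nat)
    qed
    finally have "real N0 * (h0 * (\<epsilon> / 2)) \<le> 2 * K * \<mu> * nbar + real N0 * (h0\<^sup>2 * B)"
      by (rule ennreal_le_iff[THEN iffD1, rotated]) (use K_pos \<mu>_pos nbar B in simp)
    moreover have "real N0 * (h0\<^sup>2 * B) = real N0 * (h0 * (\<epsilon> / 4))"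
      using B by (simp add: h0_def power2_eq_square)
    moreover have "real N0 * (h0 * (\<epsilon> / 2)) = 2 * (real N0 * (h0 * (\<epsilon> / 4)))" by simp
    ultimately have "real N0 * (h0 * (\<epsilon> / 4)) \<le> 2 * K * \<mu> * nbar" by linarith
    \<comment> \<open>This quantity and the bound on the gap are both proportional to \<mu>, so
      \<mu> cancels. The resulting factor \<open>2 * 96 = 192\<close> lies below the 200 in
      \<open>N0\<close>, which is the contradiction.\<close>
    moreover have "h0 * (\<epsilon> / 4) = \<epsilon>\<^sup>2 * \<mu> / (96 * K ^ 3 * nbar\<^sup>2)"
      using B \<mu>_pos by (simp add: h0_def B_def power2_eq_square field_simps)
    ultimately have "real N0 * (\<epsilon>\<^sup>2 * \<mu> / (96 * K ^ 3 * nbar\<^sup>2)) \<le> 2 * K * \<mu> * nbar"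
      by (simp only:)
    then have "real N0 \<le> 192 * K ^ 4 * (nbar ^ 3 / \<epsilon>\<^sup>2)"
      using K_pos \<mu>_pos nbar \<epsilon> by (simp add: field_simps power2_eq_square power3_eq_cube power4_eq_xxxx)
    then have "200 * (K ^ 4 * (nbar ^ 3 / \<epsilon>\<^sup>2)) \<le> 192 * (K ^ 4 * (nbar ^ 3 / \<epsilon>\<^sup>2))"
      using N0 by linarith
    moreover have "0 < K ^ 4 * (nbar ^ 3 / \<epsilon>\<^sup>2)" using K_pos nbar \<epsilon> by simp
    ultimately show False by linarith
  qed
  then obtain k where k: "k < N0" "expect_it (\<lambda>_. h0) k grad_sq \<le> ennreal (\<epsilon> / 2)" by blast
  define T where "T = 4 * K ^ 3 * m\<^sup>2 * real n / \<mu>"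
  have T: "0 \<le> T" using K_pos \<mu>_pos by (simp add: T_def)
  \<comment> \<open>From \<open>k\<close> on, the rates are geometric. \<open>T\<close> is the
    growth of the expectation per unit of rate, so step \<open>k + d\<close> adds at most
    \<open>\<epsilon> / 2 * (1 / 2) ^ Suc d\<close>, in total at most the remaining
    \<open>\<epsilon> / 2\<close>. Dividing by \<open>T + 1\<close> also covers
    \<open>T = 0\<close>.\<close>
  define h where "h j = (if j < k then h0 else \<epsilon> / (2 * (T + 1)) * (1 / 2) ^ Suc (j - k))" for j
  have h_pos: "0 < h j" for j using h0 \<epsilon> T by (simp add: h_def)
  have tail: "expect_it h (k + d) grad_sq \<le> ennreal (\<epsilon> / 2 + \<epsilon> / 2 * (1 - (1 / 2) ^ d))" for d
  proof (induction d)
    case 0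
    have "expect_it h k grad_sq = expect_it (\<lambda>_. h0) k grad_sq" by (rule expect_it_rate_cong) (simp add: h_def)
    then show ?case using k by simp
  next
    case (Suc d)
    have p: "(1 / 2 :: real) ^ d \<le> 1" by (rule power_le_one) auto
    have hT: "h (k + d) * T \<le> \<epsilon> / 2 * (1 / 2) ^ Suc d"
    proof -
      have "h (k + d) * T = \<epsilon> / 2 * (1 / 2) ^ Suc d * (T / (T + 1))" by (simp add: h_def)
      also have "\<dots> \<le> \<epsilon> / 2 * (1 / 2) ^ Suc d * 1" using \<epsilon> T by (intro mult_left_mono) auto
      finally show ?thesis by simp
    qed
    have "expect_it h (k + Suc d) grad_sq \<le> expect_it h (k + d) grad_sq + ennreal (h (k + d) * T)"
      using expect_it_grad_sq_step[of h "k + d"] h_pos by (simp add: T_def)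
    also have "\<dots> \<le> ennreal (\<epsilon> / 2 + \<epsilon> / 2 * (1 - (1 / 2) ^ d)) + ennreal (\<epsilon> / 2 * (1 / 2) ^ Suc d)"
      using hT by (intro add_mono Suc.IH ennreal_leI)
    also have "\<dots> = ennreal (\<epsilon> / 2 + \<epsilon> / 2 * (1 - (1 / 2) ^ d) + \<epsilon> / 2 * (1 / 2) ^ Suc d)"
      using \<epsilon> p by (intro ennreal_plus[symmetric] add_nonneg_nonneg mult_nonneg_nonneg) auto
    also have "\<epsilon> / 2 + \<epsilon> / 2 * (1 - (1 / 2) ^ d) + \<epsilon> / 2 * (1 / 2) ^ Suc d
        = \<epsilon> / 2 + \<epsilon> / 2 * (1 - (1 / 2) ^ Suc d)" by (simp add: algebra_simps)
    finally show ?case .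
  qed
  have "expect_it h N grad_sq \<le> ennreal \<epsilon>" if N: "200 * K ^ 4 * (nbar ^ 3 / \<epsilon>\<^sup>2) \<le> real N" for N
  proof -
    have "N0 \<le> N" using N by (simp add: N0_def nat_le_iff ceiling_le_iff)
    then obtain d where d: "N = k + d" using k(1) by (metis le_iff_add less_imp_le_nat order_trans)
    have "\<epsilon> / 2 + \<epsilon> / 2 * (1 - (1 / 2) ^ d) \<le> \<epsilon>" using \<epsilon> by (simp add: algebra_simps)
    then show ?thesis unfolding d by (rule order_trans[OF tail ennreal_leI])
  qed
  then show ?thesis using h_pos by blast
qed

text \<open>Returns from \<open>ennreal\<close> to a Bochner integral over draws 0 to
  \<open>N\<close>. Draw \<open>N\<close> belongs to the sample space although iterate
  \<open>N\<close> does not depend on it, hence \<open>expect_it_Suc_space\<close>.\<close>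

lemma gradient_it_integral:
  assumes E: "expect_it h N grad_sq \<le> ennreal \<epsilon>" and \<epsilon>: "0 \<le> \<epsilon>"
  shows "integrable (\<Pi>\<^sub>M k\<in>{..N}. D) (\<lambda>\<omega>. (vnorm n (gradient n fs (it h N \<omega>)))\<^sup>2)"
    and "(\<integral>\<omega>. (vnorm n (gradient n fs (it h N \<omega>)))\<^sup>2 \<partial>(\<Pi>\<^sub>M k\<in>{..N}. D)) \<le> \<epsilon>"
proof -
  have eq: "(vnorm n (gradient n fs (it h N \<omega>)))\<^sup>2 = grad_sq (it h N \<omega>)" for \<omega>
    by (simp add: grad_sq_def gradient_smoothed it_Rn)
  have le: "(\<integral>\<^sup>+\<omega>. ennreal (grad_sq (it h N \<omega>)) \<partial>(\<Pi>\<^sub>M k\<in>{..N}. D)) \<le> ennreal \<epsilon>"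
    using E expect_it_Suc_space[OF grad_sq_lipschitz, of N h] by (simp add: lessThan_Suc_atMost)
  show "integrable (\<Pi>\<^sub>M k\<in>{..N}. D) (\<lambda>\<omega>. (vnorm n (gradient n fs (it h N \<omega>)))\<^sup>2)"
    unfolding eq
  proof (rule integrableI_nonneg)
    show "(\<lambda>\<omega>. grad_sq (it h N \<omega>)) \<in> borel_measurable (\<Pi>\<^sub>M k\<in>{..N}. D)"
      by (rule lipschitz_it_measurable[OF grad_sq_lipschitz]) auto
    show "(\<integral>\<^sup>+\<omega>. ennreal (grad_sq (it h N \<omega>)) \<partial>(\<Pi>\<^sub>M k\<in>{..N}. D)) < \<infinity>"
      by (rule le_less_trans[OF le]) simp
  qed (simp add: grad_sq_nonneg)
  show "(\<integral>\<omega>. (vnorm n (gradient n fs (it h N \<omega>)))\<^sup>2 \<partial>(\<Pi>\<^sub>M k\<in>{..N}. D)) \<le> \<epsilon>"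
    unfolding eq by (rule integral_real_bounded[OF \<epsilon> le])
qed

end

text \<open>Let \<open>v\<close> agree with \<open>w\<close> on the active coordinates and with
  \<open>w'\<close> elsewhere. All scores of \<open>w\<close> and \<open>v\<close> coincide, so
  \<open>F\<close> has the same value at both, and the full norm of \<open>v - w'\<close> is the
  active seminorm of \<open>w - w'\<close>.\<close>

lemma active_lipschitz:
  assumes G: "\<forall>w\<in>Rn n. F w x = G (\<lambda>y\<in>Y x. vinner n w (\<phi> x y))"
    and L: "lipschitz_Rn n L (\<lambda>w. F w x)" "L \<le> K"
    and w: "w \<in> Rn n" and w': "w' \<in> Rn n"
  shows "\<bar>F w x - F w' x\<bar> \<le> K * sqrt (\<Sum>i\<in>active n Y \<phi> x. (w i - w' i)\<^sup>2)"
proof -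
  let ?A = "active n Y \<phi> x"
  define v where "v i = (if i \<in> ?A then w i else w' i)" for i
  have v: "v \<in> Rn n" using w w' by (simp add: v_def Rn_def)
  have "vinner n w (\<phi> x y) = vinner n v (\<phi> x y)" if "y \<in> Y x" for y
    unfolding vinner_def using that by (intro sum.cong) (auto simp: v_def active_def)
  then have "(\<lambda>y\<in>Y x. vinner n w (\<phi> x y)) = (\<lambda>y\<in>Y x. vinner n v (\<phi> x y))"
    by (rule restrict_ext)
  then have "F w x = F v x" using G w v by simp
  have "vnorm n (\<lambda>i. v i - w' i) = sqrt (\<Sum>i\<in>?A. (w i - w' i)\<^sup>2)"
    unfolding vnorm_def L2_set_def
    by (intro arg_cong[where f = sqrt] sum.mono_neutral_cong_right) (auto simp: v_def active_def)
  then have "\<bar>F w x - F w' x\<bar> \<le> L * sqrt (\<Sum>i\<in>?A. (w i - w' i)\<^sup>2)"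
    using L(1) v w' \<open>F w x = F v x\<close> unfolding lipschitz_Rn_def by metis
  also have "\<dots> \<le> K * sqrt (\<Sum>i\<in>?A. (w i - w' i)\<^sup>2)"
    using L(2) by (intro mult_right_mono) (auto intro: sum_nonneg)
  finally show ?thesis .
qed

theorem corollary1:
  shows "\<exists>C :: real \<Rightarrow> real \<Rightarrow> real.
    \<forall>(n :: nat) (M :: 'x measure) (Y :: 'x \<Rightarrow> 'y set) (\<phi> :: 'x \<Rightarrow> 'y \<Rightarrow> vec)
     (F :: vec \<Rightarrow> 'x \<Rightarrow> real) (L0 :: real) (fstar :: real) (nbar :: real) (\<epsilon> :: real).
      prob_space M \<and>
      (\<forall>x\<in>space M. \<forall>y\<in>Y x. \<phi> x y \<in> Rn n) \<and>
      (\<forall>i<n. {x \<in> space M. i \<in> active n Y \<phi> x} \<in> sets M) \<and>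
      (\<exists>G :: 'x \<Rightarrow> ('y \<Rightarrow> real) \<Rightarrow> real. \<forall>x\<in>space M. \<forall>w\<in>Rn n.
          F w x = G x (\<lambda>y\<in>Y x. vinner n w (\<phi> x y))) \<and>
      (\<forall>w\<in>Rn n. integrable M (F w)) \<and>
      (\<forall>x\<in>space M. \<exists>L\<le>L0. lipschitz_Rn n L (\<lambda>w. F w x)) \<and>
      (\<exists>L. lipschitz_Rn n L (objective M F)) \<and>
      (\<forall>w\<in>Rn n. fstar \<le> objective M F w) \<and>
      (\<integral>p. real (l0norm n (sparse_pert n Y \<phi> p)) \<partial>draw n M) \<le> nbar \<and>
      0 < \<epsilon>
      \<longrightarrow>
      (\<exists>(h :: nat \<Rightarrow> real) (\<mu> :: real).
        (\<forall>k. 0 < h k) \<and> 0 < \<mu> \<and>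
        (\<forall>w\<in>Rn n. \<exists>D. has_gradient n (smoothed n M Y \<phi> F \<mu>) D w) \<and>
        (\<forall>N :: nat. C L0 (objective M F (\<lambda>i. 0) - fstar) * (nbar ^ 3 / \<epsilon>\<^sup>2) \<le> real N \<longrightarrow>
          integrable (\<Pi>\<^sub>M k\<in>{..N}. draw n M)
            (\<lambda>\<omega>. (vnorm n (gradient n (smoothed n M Y \<phi> F \<mu>) (iterate n Y \<phi> F \<mu> h N \<omega>)))\<^sup>2) \<and>
          (\<integral>\<omega>. (vnorm n (gradient n (smoothed n M Y \<phi> F \<mu>) (iterate n Y \<phi> F \<mu> h N \<omega>)))\<^sup>2
             \<partial>(\<Pi>\<^sub>M k\<in>{..N}. draw n M)) \<le> \<epsilon>))"
\<comment> \<open>The constant is that of \<open>exists_learning_rates\<close>, with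
  \<open>K = \<bar>L0\<bar> + 1\<close>.\<close>
proof (intro exI[of _ "\<lambda>L0 _. 200 * (\<bar>L0\<bar> + 1) ^ 4"] allI impI, elim conjE exE)
  fix n and M :: "'x measure" and Y :: "'x \<Rightarrow> 'y set" and \<phi> F L0 fstar nbar and \<epsilon> :: real
    and G :: "'x \<Rightarrow> ('y \<Rightarrow> real) \<Rightarrow> real"
  assume M: "prob_space M" and act: "\<forall>i<n. {x \<in> space M. i \<in> active n Y \<phi> x} \<in> sets M"
    and G: "\<forall>x\<in>space M. \<forall>w\<in>Rn n. F w x = G x (\<lambda>y\<in>Y x. vinner n w (\<phi> x y))"
    and int: "\<forall>w\<in>Rn n. integrable M (F w)"
    and lip: "\<forall>x\<in>space M. \<exists>L\<le>L0. lipschitz_Rn n L (\<lambda>w. F w x)"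
    and fstar: "\<forall>w\<in>Rn n. fstar \<le> objective M F w"
    and nbar: "(\<integral>p. real (l0norm n (sparse_pert n Y \<phi> p)) \<partial>draw n M) \<le> nbar"
    and \<epsilon>: "0 < \<epsilon>"
  \<comment> \<open>This dominates every Lipschitz constant \<open>L\<close> below \<open>L0\<close>
    and is positive whatever the sign of \<open>L0\<close>.\<close>
  define K where "K = \<bar>L0\<bar> + 1"
  have loc: "sparse_smoothing n M Y \<phi> F K \<mu>" if "0 < \<mu>" for \<mu>
  proof (rule sparse_smoothing.intro)
    fix x w w' assume x: "x \<in> space M" and w: "w \<in> Rn n" "w' \<in> Rn n"
    from lip x obtain L where L: "L \<le> L0" "lipschitz_Rn n L (\<lambda>w. F w x)" by blast
    then have "L \<le> K" by (simp add: K_def)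
    with G x L w show "\<bar>F w x - F w' x\<bar> \<le> K * sqrt (\<Sum>i\<in>active n Y \<phi> x. (w i - w' i)\<^sup>2)"
      by (intro active_lipschitz[where G = "G x"]) auto
  next
    fix i w
    show "i < n \<Longrightarrow> {x \<in> space M. i \<in> active n Y \<phi> x} \<in> sets M" using act by blast
    show "w \<in> Rn n \<Longrightarrow> integrable M (F w)" using int by blast
    show "0 < K" by (simp add: K_def)
  qed (fact M that)+
  \<comment> \<open>For positive \<open>nbar\<close> this makes \<open>K * \<mu> * nbar\<close> the
    initial gap plus \<open>K * nbar\<close>, which is the requirement of
    \<open>exists_learning_rates\<close>; adding 1 keeps \<mu> positive when the gap is 0. Otherwise
    any positive value serves.\<close>
  define \<mu> where "\<mu> = (if 0 < nbar then (objective M F (\<lambda>_. 0) - fstar) / (K * nbar) + 1 else 1)"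
  have K: "0 < K" by (simp add: K_def)
  have "fstar \<le> objective M F (\<lambda>_. 0)" using fstar by (simp add: Rn_def)
  then have \<mu>: "0 < \<mu>" using K by (simp add: \<mu>_def add_nonneg_pos)
  interpret S: sparse_smoothing n M Y \<phi> F K \<mu> by (rule loc[OF \<mu>])
  have m: "S.m \<le> nbar" using nbar by (simp add: S.draw_eq S.l0norm_integral)
  have "\<exists>h. (\<forall>k. 0 < h k) \<and>
    (\<forall>N. 200 * K ^ 4 * (nbar ^ 3 / \<epsilon>\<^sup>2) \<le> real N \<longrightarrow> S.expect_it h N S.grad_sq \<le> ennreal \<epsilon>)"
  proof (cases "0 < nbar")
    case True
    have "K * \<mu> * nbar = objective M F (\<lambda>_. 0) - fstar + K * nbar"
      using True K by (simp add: \<mu>_def field_simps)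
    moreover have "0 < K * nbar" using True K by simp
    ultimately have "objective M F (\<lambda>_. 0) - fstar \<le> K * \<mu> * nbar" by linarith
    then show ?thesis
      using S.exists_learning_rates[OF _ m True \<epsilon>, of fstar] fstar by blast
  next
    \<comment> \<open>Here \<open>m\<close> is 0, almost surely nothing is perturbed and the
      gradient is identically zero, so constant rates work.\<close>
    case False
    then have "S.m = 0" using m S.m_nonneg by linarith
    then have "S.grad_sq w = 0" if "w \<in> Rn n" for w
      using S.grad_bound[OF that] by (simp add: S.grad_sq_def vnorm_sq)
    then show ?thesis
      by (intro exI[of _ "\<lambda>_. 1"]) (simp add: S.expect_it_def S.it_Rn)
  qed
  then obtain h where h: "\<forall>k. 0 < h k"
    "\<And>N. 200 * K ^ 4 * (nbar ^ 3 / \<epsilon>\<^sup>2) \<le> real N \<Longrightarrow> S.expect_it h N S.grad_sq \<le> ennreal \<epsilon>" by blast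
  show "\<exists>(h :: nat \<Rightarrow> real) (\<mu> :: real).
        (\<forall>k. 0 < h k) \<and> 0 < \<mu> \<and>
        (\<forall>w\<in>Rn n. \<exists>D. has_gradient n (smoothed n M Y \<phi> F \<mu>) D w) \<and>
        (\<forall>N :: nat. 200 * (\<bar>L0\<bar> + 1) ^ 4 * (nbar ^ 3 / \<epsilon>\<^sup>2) \<le> real N \<longrightarrow>
          integrable (\<Pi>\<^sub>M k\<in>{..N}. draw n M)
            (\<lambda>\<omega>. (vnorm n (gradient n (smoothed n M Y \<phi> F \<mu>) (iterate n Y \<phi> F \<mu> h N \<omega>)))\<^sup>2) \<and>
          (\<integral>\<omega>. (vnorm n (gradient n (smoothed n M Y \<phi> F \<mu>) (iterate n Y \<phi> F \<mu> h N \<omega>)))\<^sup>2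
             \<partial>(\<Pi>\<^sub>M k\<in>{..N}. draw n M)) \<le> \<epsilon>)"
    unfolding S.draw_eq K_def[symmetric]
    using h \<mu> S.has_gradient_smoothed S.gradient_it_integral[OF h(2) less_imp_le[OF \<epsilon>]]
    by (intro exI[of _ h] exI[of _ \<mu>]) blast
qed

end
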